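(* If $G$ is a solvable subgroup of $PL_o(I)$ with derived length $n$, then $G$ is isomorphic to a subgroup of $G_n$.
   Context: $PL_o(I)$ is the group, under composition, of orientation-preserving piecewise-linear homeomorphisms of the unit interval $I=[0,1]$ with finitely many breaks in slope. Define $G_0=1$ (the trivial group) and inductively $G_n=\bigoplus_{k\in\mathbf{Z}}(G_{n-1}\wr\mathbf{Z})$ for all positive integers $n$, where $A\wr T$ denotes the standard restricted wreath product: the semidirect product $B\rtimes T$ with $B=\bigoplus_{t\in T}A$, where $T$ acts on $B$ by right multiplication on the index of the direct sum. *)

theory Defs
  imports
    "HOL-Analysis.Analysis"
    "HOL-Algebra.Bij"
    "HOL-Algebra.Elementary_Groups"
    "HOL-Algebra.Product_Groups"
    "HOL-Algebra.Solvable_Groups"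
    "HOL-Algebra.Weak_Morphisms"
begin

definition piecewise_linear_on_I :: "(real \<Rightarrow> real) \<Rightarrow> bool" where
  "piecewise_linear_on_I f \<longleftrightarrow>
     (\<exists>B. finite B \<and>
        (\<forall>a b. 0 \<le> a \<and> a < b \<and> b \<le> 1 \<and> {a<..<b} \<inter> B = {} \<longrightarrow>
           (\<exists>m c. \<forall>x\<in>{a..b}. f x = m * x + c)))"

text \<open>As in \<^const>\<open>BijGroup\<close>, a self-map of the unit interval is represented by the function that is
  \<^const>\<open>undefined\<close> outside the interval, so that equality of group elements is equality of maps.\<close>

definition PL_o :: "(real \<Rightarrow> real) monoid" where
  "PL_o = BijGroup {0..1}
     \<lparr>carrier := {f \<in> extensional {0..1}.
        (\<exists>g. homeomorphism {0..1} {0..1} f g) \<and>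
        strict_mono_on {0..1} f \<and> piecewise_linear_on_I f}\<rparr>"

text \<open>The pair \<open>(b, s)\<close> stands for the product \<open>b s\<close>. The action moves the coordinate at \<open>x\<close> to
  \<open>x s\<close>, that is \<open>(s\<inverse> c s) (x s) = c x\<close>, and hence \<open>(s c s\<inverse>) x = c (x s)\<close>.\<close>

definition wreath_product ::
    "('a, 'c) monoid_scheme \<Rightarrow> ('t, 'd) monoid_scheme \<Rightarrow> (('t \<Rightarrow> 'a) \<times> 't) monoid" where
  "wreath_product A T =
     (let B = sum_group (carrier T) (\<lambda>_. A) in
      \<lparr>carrier = carrier B \<times> carrier T,
       monoid.mult = (\<lambda>(b, s) (c, t). (b \<otimes>\<^bsub>B\<^esub> (\<lambda>x\<in>carrier T. c (x \<otimes>\<^bsub>T\<^esub> s)), s \<otimes>\<^bsub>T\<^esub> t)),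
       one = (\<one>\<^bsub>B\<^esub>, \<one>\<^bsub>T\<^esub>)\<rparr>)"

text \<open>The underlying sets of the groups \<open>G\<^sub>n\<close> have a type that grows with \<open>n\<close>. The following type has
  room for all of them: \<open>Node\<close> is an injection into it from functions on the integers with values in
  pairs of the kind that make up a wreath product with the integers.\<close>

datatype tower = Trivial | Node "int \<Rightarrow> (int \<Rightarrow> tower) \<times> int"

text \<open>\<^const>\<open>image_group\<close> transports the group structure along the injection \<open>Node\<close>.\<close>

primrec G_tower :: "nat \<Rightarrow> tower monoid" where
  "G_tower 0 = \<lparr>carrier = {Trivial}, monoid.mult = (\<lambda>_ _. Trivial), one = Trivial\<rparr>"
| "G_tower (Suc n) =
     image_group Node (sum_group UNIV (\<lambda>k::int. wreath_product (G_tower n) integer_group))"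

definition derived_length :: "('a, 'b) monoid_scheme \<Rightarrow> nat" where
  "derived_length G = (LEAST n. (derived G ^^ n) (carrier G) = {\<one>\<^bsub>G\<^esub>})"

lemma group_wreath_product:
  assumes A: "group A" and T: "group T"
  shows "group (wreath_product A T)"
proof -
  interpret A: group A by fact
  interpret T: group T by fact
  let ?B = "sum_group (carrier T) (\<lambda>_. A)"
  interpret B: group ?B by (simp add: A)
  have cB: "carrier ?B = {x \<in> carrier T \<rightarrow>\<^sub>E carrier A. finite {i \<in> carrier T. x i \<noteq> \<one>\<^bsub>A\<^esub>}}"
    by (simp add: carrier_sum_group A)
  have sh: "(\<lambda>x\<in>carrier T. c (x \<otimes>\<^bsub>T\<^esub> s)) \<in> carrier ?B"
    if "c \<in> carrier ?B" "s \<in> carrier T" for c s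
  proof -
    have "{i \<in> carrier T. c (i \<otimes>\<^bsub>T\<^esub> s) \<noteq> \<one>\<^bsub>A\<^esub>} \<subseteq> (\<lambda>j. j \<otimes>\<^bsub>T\<^esub> inv\<^bsub>T\<^esub> s) ` {i \<in> carrier T. c i \<noteq> \<one>\<^bsub>A\<^esub>}"
    proof
      fix i assume "i \<in> {i \<in> carrier T. c (i \<otimes>\<^bsub>T\<^esub> s) \<noteq> \<one>\<^bsub>A\<^esub>}"
      then show "i \<in> (\<lambda>j. j \<otimes>\<^bsub>T\<^esub> inv\<^bsub>T\<^esub> s) ` {i \<in> carrier T. c i \<noteq> \<one>\<^bsub>A\<^esub>}"
        using that by (intro image_eqI[of _ _ "i \<otimes>\<^bsub>T\<^esub> s"]) (auto simp: T.m_assoc)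
    qed
    then have "finite {i \<in> carrier T. c (i \<otimes>\<^bsub>T\<^esub> s) \<noteq> \<one>\<^bsub>A\<^esub>}"
      using that by (auto simp: cB intro: finite_subset)
    moreover have "{i \<in> carrier T. (\<lambda>x\<in>carrier T. c (x \<otimes>\<^bsub>T\<^esub> s)) i \<noteq> \<one>\<^bsub>A\<^esub>} = {i \<in> carrier T. c (i \<otimes>\<^bsub>T\<^esub> s) \<noteq> \<one>\<^bsub>A\<^esub>}"
      by auto
    ultimately show ?thesis using that
      unfolding cB by (auto simp: PiE_iff)
  qed
  have ax: "x i \<in> carrier A" if "x \<in> carrier ?B" "i \<in> carrier T" for x i
    using that unfolding cB by auto
  have ex: "(\<lambda>i\<in>carrier T. x i) = x" if "x \<in> carrier ?B" for x
    using that unfolding cB by (auto simp: PiE_iff extensional_restrict)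
  note [simp] = ax A.m_assoc T.m_assoc
  have m: "(b, s) \<otimes>\<^bsub>wreath_product A T\<^esub> (c, t) = (b \<otimes>\<^bsub>?B\<^esub> (\<lambda>x\<in>carrier T. c (x \<otimes>\<^bsub>T\<^esub> s)), s \<otimes>\<^bsub>T\<^esub> t)" for b s c t
    by (simp add: wreath_product_def Let_def)
  have cW: "carrier (wreath_product A T) = carrier ?B \<times> carrier T"
    and oW: "\<one>\<^bsub>wreath_product A T\<^esub> = (\<one>\<^bsub>?B\<^esub>, \<one>\<^bsub>T\<^esub>)"
    by (simp_all add: wreath_product_def Let_def)
  show ?thesis
  proof (rule groupI)
    fix x y assume "x \<in> carrier (wreath_product A T)" "y \<in> carrier (wreath_product A T)"
    then show "x \<otimes>\<^bsub>wreath_product A T\<^esub> y \<in> carrier (wreath_product A T)"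
      using B.m_closed[OF _ sh] by (cases x; cases y) (auto simp: m cW simp del: mult_sum_group)
  next
    show "\<one>\<^bsub>wreath_product A T\<^esub> \<in> carrier (wreath_product A T)" using B.one_closed
      by (simp add: cW oW del: one_sum_group)
  next
    fix x y z assume "x \<in> carrier (wreath_product A T)" "y \<in> carrier (wreath_product A T)" "z \<in> carrier (wreath_product A T)"
    then show "x \<otimes>\<^bsub>wreath_product A T\<^esub> y \<otimes>\<^bsub>wreath_product A T\<^esub> z = x \<otimes>\<^bsub>wreath_product A T\<^esub> (y \<otimes>\<^bsub>wreath_product A T\<^esub> z)"
      by (cases x; cases y; cases z) (auto simp: m cW intro!: restrict_ext)
  next
    fix x assume "x \<in> carrier (wreath_product A T)"
    then show "\<one>\<^bsub>wreath_product A T\<^esub> \<otimes>\<^bsub>wreath_product A T\<^esub> x = x"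
      by (cases x) (auto simp: m cW oW ex cong: restrict_cong)
  next
    fix x assume x: "x \<in> carrier (wreath_product A T)"
    obtain b s where bs: "x = (b,s)" "b \<in> carrier ?B" "s \<in> carrier T" using x by (auto simp: cW)
    let ?y = "(\<lambda>i\<in>carrier T. (inv\<^bsub>?B\<^esub> b) (i \<otimes>\<^bsub>T\<^esub> inv\<^bsub>T\<^esub> s), inv\<^bsub>T\<^esub> s)"
    have "?y \<in> carrier (wreath_product A T)" using bs sh[OF B.inv_closed[OF bs(2)]] by (auto simp: cW)
    moreover have "?y \<otimes>\<^bsub>wreath_product A T\<^esub> x = \<one>\<^bsub>wreath_product A T\<^esub>"
    proof -
      have "inv\<^bsub>?B\<^esub> b \<otimes>\<^bsub>?B\<^esub> b = \<one>\<^bsub>?B\<^esub>" using bs by (intro B.l_inv)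
      then have "(inv\<^bsub>?B\<^esub> b) i \<otimes>\<^bsub>A\<^esub> b i = \<one>\<^bsub>A\<^esub>" if "i \<in> carrier T" for i
        using that by (simp add: fun_eq_iff restrict_def split: if_splits)
      then show ?thesis using bs by (auto simp: m oW intro!: restrict_ext)
    qed
    ultimately show "\<exists>y\<in>carrier (wreath_product A T). y \<otimes>\<^bsub>wreath_product A T\<^esub> x = \<one>\<^bsub>wreath_product A T\<^esub>"
      by blast
  qed
qed

lemma iso_Node: assumes "group X" shows "Node \<in> iso X (image_group Node X)"
proof -
  have "inj_on Node (carrier X)" by (auto simp: inj_on_def)
  then show ?thesis by (auto simp: iso_def hom_def image_group_def bij_betw_def)
qed

lemma group_G_tower: "group (G_tower n)"
proof (induction n)
  case 0 show ?case by (rule groupI) auto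
next
  case (Suc n)
  let ?X = "sum_group UNIV (\<lambda>k::int. wreath_product (G_tower n) integer_group)"
  have X: "group ?X" by (simp add: Suc group_wreath_product)
  have "group (image_group Node ?X \<lparr>one := Node \<one>\<^bsub>?X\<^esub>\<rparr>)"
    using group.iso_imp_img_group[OF X iso_Node[OF X]] .
  then show ?case by (simp add: image_group_def)
qed

lemma G_tower_Suc_iso:
  "sum_group UNIV (\<lambda>k::int. wreath_product (G_tower n) integer_group) \<cong> G_tower (Suc n)"
  using iso_Node[of "sum_group UNIV (\<lambda>k::int. wreath_product (G_tower n) integer_group)"]
  by (auto simp: is_iso_def group_G_tower group_wreath_product)

lemma subgroup_PL_o: "subgroup (carrier PL_o) (BijGroup {0..1})"
proof -
  let ?C = "carrier PL_o"
  have PLD: "f \<in> Bij {0..1}" if "f \<in> ?C" for f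
    using that by (auto simp: PL_o_def Bij_def homeomorphism_def bij_betw_def strict_mono_on_imp_inj_on)
  have bb: "bij_betw f {0..1} {0..1}" "f \<in> extensional {0..1}" "strict_mono_on {0..1} f" if "f \<in> ?C" for f
    using that by (auto simp: PL_o_def Bij_def homeomorphism_def bij_betw_def strict_mono_on_imp_inj_on)
  show ?thesis
  proof (rule group.subgroupI[OF group_BijGroup])
    show "?C \<subseteq> carrier (BijGroup {0..1})" using PLD by (auto simp: BijGroup_def)
    have "(\<lambda>x\<in>{0..1}. x) \<in> ?C"
    proof -
      have "homeomorphism {0..1} {0..1} (\<lambda>x\<in>{0..1}. x) (\<lambda>x. x::real)"
        by (rule homeomorphismI) (auto intro: continuous_on_cong[THEN iffD1, OF refl _ continuous_on_id])
      moreover have "piecewise_linear_on_I (\<lambda>x\<in>{0..1}. x)"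
        unfolding piecewise_linear_on_I_def
        by (intro exI[of _ "{}"] conjI allI impI) (simp, rule exI[of _ 1], rule exI[of _ 0], simp)
      ultimately show ?thesis by (auto simp: PL_o_def strict_mono_on_def)
    qed
    then show "?C \<noteq> {}" by blast
  next
    fix f assume f: "f \<in> ?C"
    let ?g = "\<lambda>x\<in>{0..1}. inv_into {0..1} f x"
    have inv: "inv\<^bsub>BijGroup {0..1}\<^esub> f = ?g" using PLD[OF f] by (rule inv_BijGroup)
    obtain h where h: "homeomorphism {0..1} {0..1} f h" using f by (auto simp: PL_o_def)
    have gh: "?g x = h x" if "x \<in> {0..1}" for x
      using that h bb(1)[OF f] by (auto simp: homeomorphism_def bij_betw_def inv_into_f_eq intro!: inv_into_f_eq)
    have hom: "homeomorphism {0..1} {0..1} ?g f"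
      using homeomorphism_sym[THEN iffD1, OF h] by (rule homeomorphism_cong) (use gh in auto)
    have sm: "strict_mono_on {0..1} ?g"
    proof (rule strict_mono_onI)
      fix r s :: real assume rs: "r \<in> {0..1}" "s \<in> {0..1}" "r < s"
      have "f (h r) = r" "f (h s) = s" "h r \<in> {0..1}" "h s \<in> {0..1}" using h rs by (auto simp: homeomorphism_def)
      then have "h r < h s" using rs bb(3)[OF f]
        by (metis linorder_not_le order_le_less strict_mono_onD not_less_iff_gr_or_eq)
      then show "?g r < ?g s" using gh rs by simp
    qed
    obtain B where B: "finite B" "\<And>a b. 0 \<le> a \<Longrightarrow> a < b \<Longrightarrow> b \<le> 1 \<Longrightarrow> {a<..<b} \<inter> B = {} \<Longrightarrow>
           (\<exists>m c. \<forall>x\<in>{a..b}. f x = m * x + c)"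
      using f unfolding PL_o_def piecewise_linear_on_I_def by auto
    have "piecewise_linear_on_I ?g" unfolding piecewise_linear_on_I_def
    proof (intro exI[of _ "f ` B"] conjI allI impI)
      show "finite (f ` B)" using B by simp
      fix a b :: real assume ab: "0 \<le> a \<and> a < b \<and> b \<le> 1 \<and> {a<..<b} \<inter> f ` B = {}"
      have hab: "0 \<le> h a" "h a < h b" "h b \<le> 1" "f (h a) = a" "f (h b) = b"
        using h ab strict_mono_onD[OF sm, of a b] gh by (auto simp: homeomorphism_def image_subset_iff)
      have "{h a<..<h b} \<inter> B = {}"
      proof -
        { fix y assume "y \<in> B" "h a < y" "y < h b"
          then have "a < f y" "f y < b" using strict_mono_onD[OF bb(3)[OF f], of "h a" y] strict_mono_onD[OF bb(3)[OF f], of y "h b"] hab by auto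
          then have False using ab \<open>y \<in> B\<close> by auto }
        then show ?thesis by auto
      qed
      then obtain m c where mc: "\<forall>x\<in>{h a..h b}. f x = m * x + c" using B(2)[OF hab(1-3)] by blast
      have m0: "m \<noteq> 0" using mc hab ab by force
      have "?g x = (1/m) * x + (- c/m)" if x: "x \<in> {a..b}" for x
      proof -
        have x1: "x \<in> {0..1}" using x ab by auto
        have "h a \<le> h x" "h x \<le> h b"
          using x strict_mono_onD[OF sm, of a x] strict_mono_onD[OF sm, of x b] ab gh by (auto simp: le_less)
        then have "f (h x) = m * h x + c" using mc by auto
        moreover have "f (h x) = x" using h x1 by (auto simp: homeomorphism_def)
        ultimately show ?thesis using m0 gh[OF x1] by (simp add: field_simps)
      qed
      then show "\<exists>m c. \<forall>x\<in>{a..b}. ?g x = m * x + c" by blast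
    qed
    then show "inv\<^bsub>BijGroup {0..1}\<^esub> f \<in> ?C" unfolding inv using hom sm by (auto simp: PL_o_def)
  next
    fix f g assume fg: "f \<in> ?C" "g \<in> ?C"
    have eq: "f \<otimes>\<^bsub>BijGroup {0..1}\<^esub> g = compose {0..1} f g" using PLD fg by (simp add: BijGroup_def)
    obtain f' g' where h: "homeomorphism {0..1} {0..1} f f'" "homeomorphism {0..1} {0..1} g g'" using fg by (auto simp: PL_o_def)
    have hom: "homeomorphism {0..1} {0..1} (compose {0..1} f g) (g' \<circ> f')"
      using homeomorphism_compose[OF h(2,1)] by (rule homeomorphism_cong) (auto simp: compose_def)
    have g01: "g x \<in> {0..1}" if "x \<in> {0..1}" for x using h that by (auto simp: homeomorphism_def)
    have sm: "strict_mono_on {0..1} (compose {0..1} f g)"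
      using bb(3)[OF fg(1)] bb(3)[OF fg(2)] g01 by (auto simp: strict_mono_on_def compose_def)
    obtain B where B: "finite B" "\<And>a b. 0 \<le> a \<Longrightarrow> a < b \<Longrightarrow> b \<le> 1 \<Longrightarrow> {a<..<b} \<inter> B = {} \<Longrightarrow>
           (\<exists>m c. \<forall>x\<in>{a..b}. f x = m * x + c)"
      using fg unfolding PL_o_def piecewise_linear_on_I_def by auto
    obtain D where D: "finite D" "\<And>a b. 0 \<le> a \<Longrightarrow> a < b \<Longrightarrow> b \<le> 1 \<Longrightarrow> {a<..<b} \<inter> D = {} \<Longrightarrow>
           (\<exists>m c. \<forall>x\<in>{a..b}. g x = m * x + c)"
      using fg unfolding PL_o_def piecewise_linear_on_I_def by auto
    have "piecewise_linear_on_I (compose {0..1} f g)" unfolding piecewise_linear_on_I_def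
    proof (intro exI[of _ "D \<union> g' ` B"] conjI allI impI)
      show "finite (D \<union> g' ` B)" using B D by simp
      fix a b :: real assume ab: "0 \<le> a \<and> a < b \<and> b \<le> 1 \<and> {a<..<b} \<inter> (D \<union> g' ` B) = {}"
      then obtain m c where mc: "\<forall>x\<in>{a..b}. g x = m * x + c" using D(2)[of a b] by blast
      have gm: "g x < g y" if "x \<in> {0..1}" "y \<in> {0..1}" "x < y" for x y
        using strict_mono_onD[OF bb(3)[OF fg(2)]] that by blast
      have gab: "0 \<le> g a" "g a < g b" "g b \<le> 1" using ab g01[of a] g01[of b] gm[of a b] by auto
      have "{g a<..<g b} \<inter> B = {}"
      proof -
        { fix y assume y: "y \<in> B" "g a < y" "y < g b"
          then have y1: "y \<in> {0..1}" using gab by auto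
          have *: "g (g' y) = y" "g' y \<in> {0..1}" using h y1 by (auto simp: homeomorphism_def)
          have "a < g' y" using * y gm[of "g' y" a] ab by (cases "g' y" a rule: linorder_cases) auto
          moreover have "g' y < b" using * y gm[of b "g' y"] ab by (cases "g' y" b rule: linorder_cases) auto
          ultimately have False using ab y by auto }
        then show ?thesis by auto
      qed
      then obtain k d where kd: "\<forall>x\<in>{g a..g b}. f x = k * x + d" using B(2)[OF gab] by blast
      have "compose {0..1} f g x = (k*m) * x + (k*c+d)" if x: "x \<in> {a..b}" for x
      proof -
        have "g a \<le> g x" "g x \<le> g b" using x gm[of a x] gm[of x b] ab by (auto simp: le_less)
        then show ?thesis using kd mc x ab by (auto simp: compose_def algebra_simps)
      qed
      then show "\<exists>m c. \<forall>x\<in>{a..b}. compose {0..1} f g x = m * x + c" by blast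
    qed
    then show "f \<otimes>\<^bsub>BijGroup {0..1}\<^esub> g \<in> ?C" unfolding eq using hom sm by (auto simp: PL_o_def compose_def)
  qed
qed

lemma group_PL_o: "group PL_o"
  using subgroup.subgroup_is_group[OF subgroup_PL_o group_BijGroup] by (simp add: PL_o_def)

end

theory Submission
  imports Defs
begin

text \<open>
A map is extended by the identity to the whole line, so that the restriction of a map to an interval
whose endpoints it fixes is a map of the same kind. The only traces of piecewise linearity that
matter are the one-sided slopes at each point: a map is affine on a small one-sided neighbourhood of
every point.

Let \<open>G\<close> have trivial \<open>(n+1)\<close>-st derived subgroup. By induction it suffices to embed \<open>G\<close> into
\<open>G\<^sub>n\<^sub>+\<^sub>1\<close>, given embeddings into \<open>G\<^sub>n\<close> of all groups with trivial \<open>n\<close>-th derived subgroup. The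
components of the complement of the common fixed points of \<open>G\<close>, its orbitals, are countably many,
and an element moves points in only finitely many of them, for otherwise moved points in different
orbitals would accumulate at a point near which the element is affine on each side although its
fixed points separate the moved ones (\<open>finite_if_separated_by_fixed_points\<close>). So \<open>G\<close> embeds into
the direct sum of its restrictions to the orbitals, and the task is to embed the restriction to a
single orbital \<open>(a, b)\<close> into \<open>G\<^sub>n \<wr> \<int>\<close>.

Let \<open>N\<close> be the last term of the derived series without common fixed points in \<open>(a, b)\<close>, and \<open>F\<close> the
set of fixed points of \<open>N'\<close> in \<open>(a, b)\<close>. This is a nonempty closed \<open>G\<close>-invariant set on which \<open>N\<close>
acts commutatively. Being invariant it accumulates at \<open>a\<close> and at \<open>b\<close>, where maps are linear, and
this rigidity gives an element \<open>t\<close> of \<open>N\<close> that contracts \<open>F\<close> to \<open>a\<close> and commutes on \<open>F\<close> with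
all of \<open>G\<close> (\<open>ex_closed_central_orbital\<close>). It follows that the elements with slope 1 at \<open>a\<close> fix \<open>F\<close>
pointwise and are trivial near both ends. The slopes at \<open>a\<close> form a cyclic group
(\<open>slope_generator\<close>): slopes close to 1 would force \<open>F = (a, b)\<close>, hence elements that are conjugate,
by one piecewise linear power of \<open>t\<close>, both to a scaling about \<open>a\<close> and to a scaling about \<open>b\<close>, which
is impossible.

If \<open>s\<close> has a slope that generates and \<open>K\<close> is the group of elements with slope 1 at \<open>a\<close>, then
\<open>G = K \<rtimes> \<langle>s\<rangle>\<close> on \<open>(a, b)\<close>. For \<open>p \<in> F\<close> the intervals \<open>s\<^sup>i [s p, p]\<close> tile \<open>(a, b)\<close>, their endpoints
are fixed by \<open>K\<close>, and an element of \<open>K\<close> is nontrivial on finitely many of them. This is an embedding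
into \<open>K\<^sub>0 \<wr> \<int>\<close>, where \<open>K\<^sub>0\<close> is the restriction of \<open>K\<close> to \<open>[s p, p]\<close> (\<open>wreath_hom\<close>). Finally \<open>K\<^sub>0\<close> has
trivial \<open>n\<close>-th derived subgroup: a high power of \<open>s\<close> moves the support of \<open>k \<in> K\<close> off \<open>[s p, p]\<close>, so
\<open>k\<close> agrees there with a commutator of \<open>k\<close> and that power, and \<open>K\<^sub>0\<close> is the restriction of \<open>G'\<close>
(\<open>tile_K_eq_tile_derived\<close>).
\<close>

section \<open>Germs of piecewise linear homeomorphisms\<close>

text \<open>The inverse map; \<open>inv\<close> is the notation for inverses in a group.\<close>

abbreviation finv :: "('a \<Rightarrow> 'b) \<Rightarrow> 'b \<Rightarrow> 'a" where "finv \<equiv> inv_into UNIV"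

text \<open>The parameter \<open>d\<close> is the direction in which the point \<open>c\<close> is left; only its sign matters, but
arbitrary \<open>d\<close> let slopes of composites be computed without rescaling.\<close>

definition germ_slope :: "(real \<Rightarrow> real) \<Rightarrow> real \<Rightarrow> real \<Rightarrow> real \<Rightarrow> bool" where
  "germ_slope f c d m \<longleftrightarrow> (\<exists>e>0. \<forall>y. 0 \<le> y \<and> y \<le> e \<longrightarrow> f (c + d * y) = f c + m * d * y)"

lemma germ_slopeE:
  assumes "germ_slope f c d m" "B > 0"
  obtains e where "0 < e" "e \<le> B" "\<And>y. 0 \<le> y \<Longrightarrow> y \<le> e \<Longrightarrow> f (c + d * y) = f c + m * d * y"
proof -
  obtain e where e: "e > 0" "\<And>y. 0 \<le> y \<and> y \<le> e \<Longrightarrow> f (c + d * y) = f c + m * d * y"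
    using assms unfolding germ_slope_def by blast
  show ?thesis using assms e by (intro that[of "min e B"]) auto
qed

lemma germ_slope_unique:
  assumes "germ_slope f c d m" "germ_slope f c d m'" "d \<noteq> 0"
  shows "m = m'"
proof -
  obtain e where e: "0 < e" "\<And>y. 0 \<le> y \<Longrightarrow> y \<le> e \<Longrightarrow> f (c + d * y) = f c + m * d * y"
    using germ_slopeE[OF assms(1), of 1] by auto
  obtain e' where e': "0 < e'" "\<And>y. 0 \<le> y \<Longrightarrow> y \<le> e' \<Longrightarrow> f (c + d * y) = f c + m' * d * y"
    using germ_slopeE[OF assms(2), of 1] by auto
  define y where "y = min e e'"
  have y: "0 < y" "y \<le> e" "y \<le> e'" using e(1) e'(1) by (auto simp: y_def)
  have "f (c + d * y) = f c + m * d * y" "f (c + d * y) = f c + m' * d * y"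
    by (rule e(2) e'(2); use y in linarith)+
  then have "m * (d * y) = m' * (d * y)" by (simp only: mult.assoc add_left_cancel)
  then show ?thesis using y(1) assms(3) by simp
qed

lemma germ_slope_scale:
  assumes "r > 0" "germ_slope f c d m"
  shows "germ_slope f c (r * d) m"
proof -
  obtain e where e: "e > 0" "\<And>y. 0 \<le> y \<and> y \<le> e \<Longrightarrow> f (c + d * y) = f c + m * d * y"
    using assms unfolding germ_slope_def by blast
  have "f (c + r * d * y) = f c + m * (r * d) * y" if "0 \<le> y" "y \<le> e / r" for y
    using e(2)[of "r * y"] that assms(1) by (simp add: field_simps)
  then show ?thesis using e(1) assms(1) unfolding germ_slope_def by (intro exI[of _ "e / r"]) auto
qed

lemma germ_slope_comp:
  assumes "germ_slope g c d m" "germ_slope f (g c) (m * d) m'"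
  shows "germ_slope (f \<circ> g) c d (m' * m)"
proof -
  obtain e where e: "0 < e" "\<And>y. 0 \<le> y \<Longrightarrow> y \<le> e \<Longrightarrow> g (c + d * y) = g c + m * d * y"
    using germ_slopeE[OF assms(1), of 1] by auto
  obtain e' where e': "0 < e'" "e' \<le> e" "\<And>y. 0 \<le> y \<Longrightarrow> y \<le> e' \<Longrightarrow> f (g c + (m * d) * y) = f (g c) + m' * (m * d) * y"
    using germ_slopeE[OF assms(2) e(1)] by auto
  show ?thesis unfolding germ_slope_def using e e' by (intro exI[of _ e']) (auto simp: mult.assoc)
qed

lemma germ_slope_comp_fixed:
  assumes "germ_slope g c d m" "germ_slope f c d m'" "m > 0" "g c = c"
  shows "germ_slope (f \<circ> g) c d (m' * m)"
  using germ_slope_comp[OF assms(1)] germ_slope_scale[OF assms(3,2)] assms(4) by simp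

lemma germ_slope_inv:
  assumes "bij f" "germ_slope f c d m" "m > 0"
  shows "germ_slope (finv f) (f c) d (1 / m)"
proof -
  obtain e where e: "e > 0" "\<And>y. 0 \<le> y \<and> y \<le> e \<Longrightarrow> f (c + d * y) = f c + m * d * y"
    using assms unfolding germ_slope_def by blast
  have "finv f (f c + d * y) = finv f (f c) + 1 / m * d * y" if y: "0 \<le> y" "y \<le> m * e" for y
  proof -
    have "f (c + d * (y / m)) = f c + d * y"
      using e(2)[of "y / m"] y assms(3) by (simp add: field_simps)
    then have "finv f (f c + d * y) = c + d * (y / m)"
      using assms(1) by (metis bij_is_inj inv_f_f)
    then show ?thesis using assms(1) by (simp add: bij_is_inj inv_f_f)
  qed
  then show ?thesis unfolding germ_slope_def using e(1) assms(3) by (intro exI[of _ "m * e"]) auto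
qed

lemma germ_slope_id: "germ_slope (\<lambda>x. x) c d 1"
  unfolding germ_slope_def by (intro exI[of _ 1]) auto

lemma germ_slope_cong:
  assumes "germ_slope f c d m" "e > 0" "\<And>y. 0 \<le> y \<Longrightarrow> y \<le> e \<Longrightarrow> f' (c + d * y) = f (c + d * y)"
  shows "germ_slope f' c d m"
proof -
  obtain e' where e': "0 < e'" "e' \<le> e" "\<And>y. 0 \<le> y \<Longrightarrow> y \<le> e' \<Longrightarrow> f (c + d * y) = f c + m * d * y"
    using germ_slopeE[OF assms(1,2)] by auto
  show ?thesis unfolding germ_slope_def using e' assms(2) assms(3)[of 0] assms(3) by (intro exI[of _ e']) auto
qed

text \<open>An affine germ that fixes two points is the identity.\<close>

lemma germ_slope_one_if_fixed_points_accumulate: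
  assumes "germ_slope f c d m" "f c = c" "d \<noteq> 0" "\<And>e. e > 0 \<Longrightarrow> \<exists>y. 0 < y \<and> y < e \<and> f (c + d * y) = c + d * y"
  shows "m = 1"
proof -
  obtain e where e: "0 < e" "\<And>y. 0 \<le> y \<Longrightarrow> y \<le> e \<Longrightarrow> f (c + d * y) = f c + m * d * y"
    using germ_slopeE[OF assms(1), of 1] by auto
  obtain y where y: "0 < y" "y < e" "f (c + d * y) = c + d * y" using assms(4)[OF e(1)] by blast
  then have "m * d * y = d * y" using e(2)[of y] assms(2) by simp
  then show ?thesis using y assms(3) by simp
qed

text \<open>By compactness of the unit interval, maps with one-sided slopes everywhere have finitely many breaks,
so this is \<^const>\<open>PL_o\<close> with its elements extended by the identity.\<close>

definition PLH :: "(real \<Rightarrow> real) monoid" where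
  "PLH = \<lparr>carrier = {f. strict_mono f \<and> surj f \<and> (\<forall>c d. \<exists>m>0. germ_slope f c d m) \<and>
                        (\<forall>x. x \<notin> {0..1} \<longrightarrow> f x = x)},
          monoid.mult = (\<circ>), one = id\<rparr>"

lemma PLH_mult [simp]: "f \<otimes>\<^bsub>PLH\<^esub> g = f \<circ> g" and PLH_one [simp]: "\<one>\<^bsub>PLH\<^esub> = id"
  by (simp_all add: PLH_def)

lemma PLH_bij: "f \<in> carrier PLH \<Longrightarrow> bij f"
  by (auto simp: PLH_def bij_def strict_mono_imp_inj_on)

lemma PLH_less_iff: "f \<in> carrier PLH \<Longrightarrow> f x < f y \<longleftrightarrow> x < y"
  by (auto simp: PLH_def strict_mono_less)

lemma PLH_le_iff: "f \<in> carrier PLH \<Longrightarrow> f x \<le> f y \<longleftrightarrow> x \<le> y"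
  by (auto simp: PLH_def strict_mono_less_eq)

lemma PLH_eq_iff: "f \<in> carrier PLH \<Longrightarrow> f x = f y \<longleftrightarrow> x = y"
  by (auto simp: PLH_def strict_mono_eq)

lemma PLH_germ:
  assumes "f \<in> carrier PLH" obtains m where "m > 0" "germ_slope f c d m"
proof -
  have "\<exists>m>0. germ_slope f c d m" using assms by (simp add: PLH_def)
  then show thesis using that by blast
qed

lemma PLH_fix_outside: "f \<in> carrier PLH \<Longrightarrow> x \<notin> {0..1} \<Longrightarrow> f x = x"
  by (simp add: PLH_def)

lemma inv_mem_PLH:
  assumes f: "f \<in> carrier PLH" shows "finv f \<in> carrier PLH"
proof -
  have b: "bij f" using PLH_bij[OF f] .
  have fi: "f (finv f x) = x" for x using b by (simp add: bij_is_surj surj_f_inv_f)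
  have "strict_mono (finv f)"
    by (rule strict_monoI) (metis PLH_less_iff[OF f] fi)
  moreover have "surj (finv f)" using b by (simp add: bij_imp_bij_inv bij_is_surj)
  moreover have "\<exists>m>0. germ_slope (finv f) c d m" for c d
  proof -
    obtain m where "m > 0" "germ_slope f (finv f c) d m" using PLH_germ[OF f] .
    then have "germ_slope (finv f) c d (1 / m)" using germ_slope_inv[OF b, of "finv f c" d m] fi by simp
    then show ?thesis using \<open>m > 0\<close> by (intro exI[of _ "1 / m"]) auto
  qed
  moreover have "finv f x = x" if "x \<notin> {0..1}" for x
    using PLH_fix_outside[OF f that] b by (metis bij_inv_eq_iff)
  ultimately show ?thesis by (simp add: PLH_def)
qed

lemma comp_mem_PLH:
  assumes f: "f \<in> carrier PLH" and g: "g \<in> carrier PLH" shows "f \<circ> g \<in> carrier PLH"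
proof -
  have "\<exists>m>0. germ_slope (f \<circ> g) c d m" for c d
  proof -
    obtain m where "m > 0" "germ_slope g c d m" using PLH_germ[OF g] .
    moreover obtain m' where "m' > 0" "germ_slope f (g c) (m * d) m'" using PLH_germ[OF f] .
    ultimately show ?thesis using germ_slope_comp by (intro exI[of _ "m' * m"]) auto
  qed
  moreover have "strict_mono (f \<circ> g)" using f g by (auto simp: strict_mono_def PLH_less_iff[OF f] PLH_less_iff[OF g])
  moreover have "surj (f \<circ> g)" using f g comp_surj[of g f] unfolding PLH_def by auto
  ultimately show ?thesis using PLH_fix_outside[OF f] PLH_fix_outside[OF g] by (simp add: PLH_def)
qed

lemma group_PLH: "group PLH"
proof (rule groupI)
  show "\<one>\<^bsub>PLH\<^esub> \<in> carrier PLH"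
    using germ_slope_id by (auto simp: PLH_def strict_mono_def id_def intro!: exI[of _ 1])
  show "\<exists>y\<in>carrier PLH. y \<otimes>\<^bsub>PLH\<^esub> x = \<one>\<^bsub>PLH\<^esub>" if "x \<in> carrier PLH" for x
    using inv_mem_PLH[OF that] PLH_bij[OF that] by (intro bexI[of _ "finv x"]) (auto simp: bij_is_inj)
qed (simp_all add: comp_mem_PLH comp_assoc)

interpretation PLH: group PLH by (rule group_PLH)

lemma inv_PLH: "f \<in> carrier PLH \<Longrightarrow> inv\<^bsub>PLH\<^esub> f = finv f"
  using inv_mem_PLH PLH_bij by (intro PLH.inv_equality) (auto simp: bij_is_inj)

lemma subgroup_PLH_D:
  assumes "subgroup G PLH"
  shows "\<And>f. f \<in> G \<Longrightarrow> f \<in> carrier PLH" "id \<in> G" "\<And>f g. f \<in> G \<Longrightarrow> g \<in> G \<Longrightarrow> f \<circ> g \<in> G"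
        "\<And>f. f \<in> G \<Longrightarrow> finv f \<in> G"
proof -
  show "f \<in> carrier PLH" if "f \<in> G" for f using subgroup.mem_carrier[OF assms that] .
  then show "finv f \<in> G" if "f \<in> G" for f
    using subgroup.m_inv_closed[OF assms that] inv_PLH[of f] that by simp
qed (use subgroup.one_closed[OF assms] subgroup.m_closed[OF assms] in simp_all)

lemma subgroup_PLH_I:
  assumes "G \<subseteq> carrier PLH" "id \<in> G" "\<And>f g. f \<in> G \<Longrightarrow> g \<in> G \<Longrightarrow> f \<circ> g \<in> G"
    "\<And>f. f \<in> G \<Longrightarrow> finv f \<in> G"
  shows "subgroup G PLH"
proof (rule PLH.subgroupI)
  show "inv\<^bsub>PLH\<^esub> f \<in> G" if "f \<in> G" for f
    using assms(1,4) that inv_PLH[of f] by auto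
qed (use assms in auto)

lemma PLH_inv_f [simp]: "f \<in> carrier PLH \<Longrightarrow> finv f (f x) = x"
  and PLH_f_inv: "f \<in> carrier PLH \<Longrightarrow> f (finv f x) = x"
  using PLH_bij by (auto simp: bij_is_inj bij_is_surj surj_f_inv_f)

lemma PLH_inv_eq_iff: "f \<in> carrier PLH \<Longrightarrow> finv f x = y \<longleftrightarrow> x = f y"
  by (metis PLH_inv_f PLH_f_inv)

definition restrict_id :: "real \<Rightarrow> real \<Rightarrow> (real \<Rightarrow> real) \<Rightarrow> real \<Rightarrow> real" where
  "restrict_id a b f x = (if a \<le> x \<and> x \<le> b then f x else x)"

lemma PLH_maps_interval:
  assumes "f \<in> carrier PLH" "f a = a" "f b = b"
  shows "a \<le> f x \<longleftrightarrow> a \<le> x" "f x \<le> b \<longleftrightarrow> x \<le> b" "a < f x \<longleftrightarrow> a < x" "f x < b \<longleftrightarrow> x < b"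
  using PLH_le_iff[OF assms(1)] PLH_less_iff[OF assms(1)] assms(2,3) by metis+

lemma restrict_id_outside:
  assumes "f a = a" "f b = b" "a \<le> b" "x \<le> a \<or> b \<le> x"
  shows "restrict_id a b f x = x"
  using assms unfolding restrict_id_def by (metis order.antisym)

text \<open>On a small one-sided neighbourhood of any point the restriction agrees with \<open>f\<close> or with the identity;
at the endpoints this depends on the direction, and there slopes of \<open>f\<close> matter only towards the
interior.\<close>

lemma restrict_id_germ:
  assumes fab: "f a = a" "f b = b" "a \<le> b"
    and germ: "\<And>c d. a \<le> c \<Longrightarrow> c \<le> b \<Longrightarrow> (d > 0 \<and> c < b) \<or> (d < 0 \<and> a < c) \<Longrightarrow> \<exists>m>0. germ_slope f c d m"
  shows "\<exists>m>0. germ_slope (restrict_id a b f) c d m"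
proof -
  let ?r = "restrict_id a b f"
  note out = restrict_id_outside[OF fab]
  have div: "z * y \<le> A" if "0 < z" "y \<le> A / z" for z y A :: real
    using that by (simp add: pos_le_divide_eq mult.commute)
  consider "d = 0" | "d > 0" "a \<le> c" "c < b" | "d < 0" "a < c" "c \<le> b"
    | "d > 0" "c < a" | "d > 0" "b \<le> c" | "d < 0" "c \<le> a" | "d < 0" "b < c" by linarith
  then show ?thesis
  proof cases
    case 1 then show ?thesis unfolding germ_slope_def by (intro exI[of _ 1] conjI) auto
  next
    case 2
    obtain m where m: "m > 0" "germ_slope f c d m" using germ[of c d] 2 by auto
    have "germ_slope ?r c d m"
    proof (rule germ_slope_cong[OF m(2)])
      show "(b - c) / d > 0" using 2 by simp
      fix y :: real assume "0 \<le> y" "y \<le> (b - c) / d"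
      then have "0 \<le> d * y" "d * y \<le> b - c"
        using 2 div[of d y "b - c"] by (auto intro: mult_nonneg_nonneg)
      then have "a \<le> c + d * y" "c + d * y \<le> b" using 2 by auto
      then show "?r (c + d * y) = f (c + d * y)" by (simp add: restrict_id_def)
    qed
    then show ?thesis using m by blast
  next
    case 3
    obtain m where m: "m > 0" "germ_slope f c d m" using germ[of c d] 3 by auto
    have "germ_slope ?r c d m"
    proof (rule germ_slope_cong[OF m(2)])
      show "(c - a) / (- d) > 0" using 3 by (intro divide_pos_pos) auto
      fix y :: real assume "0 \<le> y" "y \<le> (c - a) / (- d)"
      then have "0 \<le> (-d) * y" "(-d) * y \<le> c - a"
        using 3 div[of "-d" y "c - a"] by (auto intro: mult_nonneg_nonneg mult_nonpos_nonneg)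
      then have "a \<le> c + d * y" "c + d * y \<le> b" using 3 by auto
      then show "?r (c + d * y) = f (c + d * y)" by (simp add: restrict_id_def)
    qed
    then show ?thesis using m by blast
  next
    case 4
    have "germ_slope ?r c d 1"
    proof (rule germ_slope_cong[OF germ_slope_id])
      show "(a - c) / d > 0" using 4 by simp
      fix y :: real assume "0 \<le> y" "y \<le> (a - c) / d"
      then have "d * y \<le> a - c" using 4 div[of d y "a - c"] by simp
      then show "?r (c + d * y) = c + d * y" using 4 by (intro out) linarith
    qed
    then show ?thesis by (intro exI[of _ 1]) auto
  next
    case 5
    have "germ_slope ?r c d 1"
    proof (rule germ_slope_cong[OF germ_slope_id zero_less_one])
      fix y :: real assume "0 \<le> y" "y \<le> 1"
      then have "0 \<le> d * y" using 5 by (simp add: mult_nonneg_nonneg)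
      then show "?r (c + d * y) = c + d * y" using 5 by (intro out) linarith
    qed
    then show ?thesis by (intro exI[of _ 1]) auto
  next
    case 6
    have "germ_slope ?r c d 1"
    proof (rule germ_slope_cong[OF germ_slope_id zero_less_one])
      fix y :: real assume "0 \<le> y" "y \<le> 1"
      then have "d * y \<le> 0" using 6 by (simp add: mult_nonpos_nonneg)
      then show "?r (c + d * y) = c + d * y" using 6 by (intro out) linarith
    qed
    then show ?thesis by (intro exI[of _ 1]) auto
  next
    case 7
    have "germ_slope ?r c d 1"
    proof (rule germ_slope_cong[OF germ_slope_id])
      show "(c - b) / (- d) > 0" using 7 by (intro divide_pos_pos) auto
      fix y :: real assume "0 \<le> y" "y \<le> (c - b) / (- d)"
      then have "(-d) * y \<le> c - b" using 7 div[of "-d" y "c - b"] by simp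
      then show "?r (c + d * y) = c + d * y" using 7 by (intro out) linarith
    qed
    then show ?thesis by (intro exI[of _ 1]) auto
  qed
qed

lemma restrict_id_mem_PLH:
  assumes f: "f \<in> carrier PLH" and fab: "f a = a" "f b = b" and ab: "a \<le> b"
  shows "restrict_id a b f \<in> carrier PLH"
proof -
  note I = PLH_maps_interval[OF f fab]
  let ?r = "restrict_id a b f"
  have "strict_mono ?r"
  proof (rule strict_monoI)
    fix x y :: real assume xy: "x < y"
    then have "f x < f y" using PLH_less_iff[OF f] by simp
    then show "?r x < ?r y" using xy I[of x] I[of y] by (auto simp: restrict_id_def)
  qed
  moreover have "surj ?r"
  proof (rule surjI)
    fix x show "?r (if a \<le> x \<and> x \<le> b then finv f x else x) = x"
      using I[of "finv f x"] PLH_f_inv[OF f] by (auto simp: restrict_id_def)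
  qed
  moreover have "\<exists>m>0. germ_slope ?r c d m" for c d
    by (rule restrict_id_germ[OF fab ab]) (use PLH_germ[OF f] in metis)
  moreover have "?r x = x" if "x \<notin> {0..1}" for x
    using PLH_fix_outside[OF f that] by (simp add: restrict_id_def)
  ultimately show ?thesis by (simp add: PLH_def)
qed

lemma restrict_id_comp:
  assumes "g \<in> carrier PLH" "g a = a" "g b = b"
  shows "restrict_id a b (f \<circ> g) = restrict_id a b f \<circ> restrict_id a b g"
  using PLH_maps_interval[OF assms] by (auto simp: restrict_id_def fun_eq_iff)

lemma restrict_id_eq_id_iff: "restrict_id a b f = id \<longleftrightarrow> (\<forall>x. a \<le> x \<and> x \<le> b \<longrightarrow> f x = x)"
  by (auto simp: restrict_id_def fun_eq_iff)

text \<open>Stated for a direction \<open>d\<close> so as to cover contractions towards either end of an interval.\<close>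

lemma contraction_pow:
  fixes s :: "real \<Rightarrow> real"
  assumes s: "\<And>y. 0 \<le> y \<Longrightarrow> y \<le> e \<Longrightarrow> s (c + d * y) = c + d * (r * y)" and r: "0 < r" "r < 1" and z: "0 \<le> z" "z \<le> e"
  shows "(s ^^ j) (c + d * z) = c + d * (r ^ j * z)"
proof (induction j)
  case (Suc j)
  have "r ^ j * z \<le> 1 * z" by (rule mult_right_mono[OF power_le_one]) (use r z in auto)
  then show ?case using Suc s[of "r ^ j * z"] r z by (simp add: mult.assoc)
qed simp

lemma power_times_small:
  fixes r z \<epsilon> :: real
  assumes "0 < r" "r < 1" "0 < \<epsilon>"
  shows "\<exists>j. r ^ j * z < \<epsilon>"
proof -
  have "(\<lambda>j. r ^ j * z) \<longlonglongrightarrow> 0 * z" using assms by (intro tendsto_mult tendsto_const LIMSEQ_power_zero) auto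
  then have "\<forall>\<^sub>F j in sequentially. r ^ j * z < \<epsilon>" using assms by (intro order_tendstoD) auto
  then show ?thesis by (auto simp: eventually_sequentially)
qed

text \<open>Close to the fixed point \<open>c\<close> the map \<open>g\<close> is linear by definition of its slope, and conjugation by a
power of the linear contraction \<open>t\<close> transports this to the whole interval on which \<open>t\<close> is linear.
The size of that interval is independent of \<open>g\<close>. The commutation hypothesis concerns one point only,
because it will be available only on a subset of the line.\<close>

lemma linear_if_commutes_with_contraction:
  assumes t: "\<And>y. 0 \<le> y \<Longrightarrow> y \<le> e \<Longrightarrow> t (c + d * y) = c + d * (\<tau> * y)" and \<tau>: "0 < \<tau>" "\<tau> < 1"
    and g: "germ_slope g c d m" "g c = c"
    and comm: "\<And>j. g ((t ^^ j) (c + d * x)) = (t ^^ j) (g (c + d * x))"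
    and x: "0 \<le> x" "x \<le> e" and gx: "g (c + d * x) = c + d * y" "0 \<le> y" "y \<le> e" and d: "d \<noteq> 0"
  shows "y = m * x"
proof -
  note tj = contraction_pow[of e t c d \<tau>, OF t \<tau>]
  obtain \<epsilon> where \<epsilon>: "0 < \<epsilon>" "\<And>y. 0 \<le> y \<Longrightarrow> y \<le> \<epsilon> \<Longrightarrow> g (c + d * y) = g c + m * d * y"
    using germ_slopeE[OF g(1), of 1] by auto
  obtain j where j: "\<tau> ^ j * x < \<epsilon>" using power_times_small[OF \<tau> \<epsilon>(1)] by blast
  have "c + m * d * (\<tau> ^ j * x) = g (c + d * (\<tau> ^ j * x))" using \<epsilon>(2)[of "\<tau> ^ j * x"] j \<tau> x g(2) by simp
  also have "\<dots> = c + d * (\<tau> ^ j * y)" using comm[of j] tj[OF _ _ x] tj[OF _ _ gx(2,3)] gx(1) by simp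
  finally show ?thesis using \<tau> d by simp
qed

lemma germ_slope_one_right:
  assumes "germ_slope f c 1 1" "f c = c"
  obtains x where "c < x" "\<And>y. c \<le> y \<Longrightarrow> y \<le> x \<Longrightarrow> f y = y"
proof -
  obtain e where e: "0 < e" "\<And>y. 0 \<le> y \<Longrightarrow> y \<le> e \<Longrightarrow> f (c + 1 * y) = f c + 1 * 1 * y"
    using germ_slopeE[OF assms(1), of 1] by auto
  show ?thesis
  proof (rule that[of "c + e"])
    fix y assume "c \<le> y" "y \<le> c + e"
    then show "f y = y" using e(2)[of "y - c"] assms(2) by simp
  qed (use e in simp)
qed

lemma germ_slope_one_left:
  assumes "germ_slope f c (-1) 1" "f c = c"
  obtains x where "x < c" "\<And>y. x \<le> y \<Longrightarrow> y \<le> c \<Longrightarrow> f y = y"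
proof -
  obtain e where e: "0 < e" "\<And>y. 0 \<le> y \<Longrightarrow> y \<le> e \<Longrightarrow> f (c + -1 * y) = f c + 1 * -1 * y"
    using germ_slopeE[OF assms(1), of 1] by auto
  show ?thesis
  proof (rule that[of "c - e"])
    fix y assume "c - e \<le> y" "y \<le> c"
    then show "f y = y" using e(2)[of "c - y"] assms(2) by simp
  qed (use e in simp)
qed

text \<open>The generator is the largest element below 1.\<close>

lemma discrete_multiplicative_subgroup_cyclic:
  fixes S :: "real set"
  assumes pos: "\<And>m. m \<in> S \<Longrightarrow> 0 < m" and mult: "\<And>m n. m \<in> S \<Longrightarrow> n \<in> S \<Longrightarrow> m * n \<in> S"
    and invs: "\<And>m. m \<in> S \<Longrightarrow> 1 / m \<in> S"
    and \<tau>: "\<tau> \<in> S" "\<tau> < 1" and L: "L < 1" "\<And>m. m \<in> S \<Longrightarrow> m < 1 \<Longrightarrow> m \<le> L"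
  obtains l where "l \<in> S" "l < 1" "\<And>m. m \<in> S \<Longrightarrow> \<exists>k::int. m = l powi k"
proof -
  define l where "l = Sup {m \<in> S. m < 1}"
  have bdd: "bdd_above {m \<in> S. m < 1}" by (rule bdd_aboveI[of _ 1]) auto
  have up: "m \<le> l" if "m \<in> S" "m < 1" for m
    unfolding l_def using that bdd by (intro cSup_upper) auto
  have "l \<le> L" unfolding l_def using \<tau> L by (intro cSup_least) auto
  have l: "0 < l" "l < 1" using up[OF \<tau>] pos[OF \<tau>(1)] \<open>l \<le> L\<close> L(1) by auto
  have approx: "\<exists>m\<in>S. m < 1 \<and> z < m" if "z < l" for z
    using that \<tau> less_cSup_iff[OF _ bdd, of z] unfolding l_def by auto
  have "l \<in> S"
  proof (rule ccontr)
    assume "l \<notin> S"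
    have "l\<^sup>2 < l" using l by (simp add: power2_eq_square)
    then obtain m where m: "m \<in> S" "m < 1" "l\<^sup>2 < m" using approx by blast
    have "m < l" using up[OF m(1,2)] m(1) \<open>l \<notin> S\<close> by (metis order_le_less)
    then obtain n where n: "n \<in> S" "n < 1" "m < n" using approx by blast
    \<comment> \<open>the quotient of two elements of \<open>S\<close> in \<open>(l\<^sup>2, l]\<close> would lie strictly between \<open>l\<close> and 1\<close>
    have "m / n \<in> S" using mult[OF m(1) invs[OF n(1)]] by simp
    moreover have "m / n < 1" using n pos by simp
    ultimately have "m / n \<le> l" by (rule up)
    then have "m \<le> l * n" using pos[OF n(1)] by (simp add: pos_divide_le_eq)
    also have "\<dots> \<le> l * l" using up[OF n(1,2)] l by (intro mult_left_mono) auto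
    finally show False using m(3) by (simp add: power2_eq_square)
  qed
  have one: "1 \<in> S" using mult[OF \<tau>(1) invs[OF \<tau>(1)]] pos[OF \<tau>(1)] by simp
  have pw: "l ^ n \<in> S" for n by (induction n) (use one mult \<open>l \<in> S\<close> in auto)
  have pwi: "l powi k \<in> S" for k
    using pw[of "nat k"] invs[OF pw[of "nat (-k)"]] by (auto simp: power_int_def field_simps)
  have "\<exists>k::int. m = l powi k" if m: "m \<in> S" for m
  proof -
    define k where "k = \<lfloor>ln m / ln l\<rfloor>"
    define r where "r = m * l powi (- k)"
    have "ln l < 0" using l by simp
    have r: "r \<in> S" using mult[OF m pwi] by (simp add: r_def)
    have "ln r = ln m + ln (l powi (- k))"
      unfolding r_def using pos[OF m] l by (simp add: ln_mult)
    also have "ln (l powi (- k)) = - k * ln l" 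
      using l by (cases "k \<le> 0") (simp_all add: power_int_def ln_realpow ln_inverse)
    finally have eq: "ln r = (ln m / ln l - k) * ln l" using \<open>ln l < 0\<close> by (simp add: algebra_simps)
    have x: "0 \<le> ln m / ln l - k" "ln m / ln l - k < 1" unfolding k_def by linarith+
    have "ln r \<le> 0" unfolding eq by (rule mult_nonneg_nonpos[OF x(1)]) (use \<open>ln l < 0\<close> in simp)
    moreover have "1 * ln l < ln r" unfolding eq by (rule mult_strict_right_mono_neg[OF x(2) \<open>ln l < 0\<close>])
    ultimately have "ln r \<le> 0" "ln l < ln r" by simp_all
    then have "r \<le> 1" "l < r" using pos[OF r] l by auto
    then have "r = 1" using up[OF r] by force
    then show ?thesis using l by (intro exI[of _ k]) (simp add: r_def power_int_minus field_simps)
  qed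
  then show ?thesis using that \<open>l \<in> S\<close> l(2) by blast
qed

section \<open>Orbitals\<close>

text \<open>An interval \<open>(a, b)\<close> that is a component of the set of points moved by \<open>G\<close>.\<close>

locale orbital =
  fixes G :: "(real \<Rightarrow> real) set" and a b :: real
  assumes G: "subgroup G PLH" and ab: "a < b"
    and fixes_a: "g \<in> G \<Longrightarrow> g a = a" and fixes_b: "g \<in> G \<Longrightarrow> g b = b"
    and moves: "a < x \<Longrightarrow> x < b \<Longrightarrow> \<exists>g\<in>G. g x \<noteq> x"
begin

lemmas in_PLH = subgroup_PLH_D(1)[OF G]
lemmas id_mem = subgroup_PLH_D(2)[OF G]
lemmas comp_mem = subgroup_PLH_D(3)[OF G]
lemmas finv_mem = subgroup_PLH_D(4)[OF G]

lemma interval_iff: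
  assumes "g \<in> G"
  shows "a < g x \<longleftrightarrow> a < x" "g x < b \<longleftrightarrow> x < b"
  using PLH_maps_interval[OF in_PLH[OF assms] fixes_a[OF assms] fixes_b[OF assms]] by auto

text \<open>The infimum of an orbit is fixed by \<open>G\<close>.\<close>

lemma orbit_near_a:
  assumes "a < p" "p < b" "a < x"
  shows "\<exists>g\<in>G. g p < x"
proof (rule ccontr)
  assume "\<not> ?thesis"
  then have no: "x \<le> g p" if "g \<in> G" for g using that by force
  define q where "q = Inf ((\<lambda>g. g p) ` G)"
  have bdd: "bdd_below ((\<lambda>g. g p) ` G)" using no by (intro bdd_belowI[of _ x]) auto
  have lower: "q \<le> g p" if "g \<in> G" for g unfolding q_def using bdd that by (intro cInf_lower) auto
  have "x \<le> q" unfolding q_def using no id_mem by (intro cInf_greatest) auto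
  then have "a < q" "q < b" using assms lower[OF id_mem] by auto
  have down: "finv h q \<le> q" if h: "h \<in> G" for h
    unfolding q_def[symmetric]
  proof (subst (2) q_def, rule cInf_greatest)
    show "(\<lambda>g. g p) ` G \<noteq> {}" using id_mem by auto
    fix y assume "y \<in> (\<lambda>g. g p) ` G"
    then obtain g where g: "g \<in> G" "y = g p" by auto
    have "q \<le> h (g p)" using lower[OF comp_mem[OF h g(1)]] by simp
    then have "h (finv h q) \<le> h (g p)" using PLH_f_inv[OF in_PLH[OF h]] by simp
    then show "finv h q \<le> y" using g PLH_le_iff[OF in_PLH[OF h]] by simp
  qed
  have "h q = q" if h: "h \<in> G" for h
  proof (rule order.antisym)
    have "h (finv h q) \<le> h q" using down[OF h] PLH_le_iff[OF in_PLH[OF h]] by simp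
    then show "q \<le> h q" using PLH_f_inv[OF in_PLH[OF h]] by simp
    have "finv h (finv (finv h) q) \<le> finv h q"
      using down[OF finv_mem[OF h]] PLH_le_iff[OF in_PLH[OF finv_mem[OF h]]] by simp
    then have "q \<le> finv h q" using PLH_f_inv[OF in_PLH[OF finv_mem[OF h]]] by simp
    then have "h q \<le> h (finv h q)" using PLH_le_iff[OF in_PLH[OF h]] by simp
    then show "h q \<le> q" using PLH_f_inv[OF in_PLH[OF h]] by simp
  qed
  then show False using moves \<open>a < q\<close> \<open>q < b\<close> by blast
qed

lemma orbit_near_b:
  assumes "a < p" "p < b" "x < b"
  shows "\<exists>g\<in>G. x < g p"
proof -
  \<comment> \<open>moving \<open>x\<close> below \<open>p\<close> is the same as moving \<open>p\<close> above \<open>x\<close>\<close>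
  define y where "y = max x p"
  have "a < y" "y < b" using assms by (auto simp: y_def)
  then obtain z where z: "a < z" "z < p" using assms dense by blast
  obtain g where g: "g \<in> G" "g y < z" using orbit_near_a[OF \<open>a < y\<close> \<open>y < b\<close> z(1)] by blast
  then have "g y < g (finv g p)" using z PLH_f_inv[OF in_PLH[OF g(1)]] by simp
  then have "y < finv g p" using PLH_less_iff[OF in_PLH[OF g(1)]] by simp
  then show ?thesis using finv_mem[OF g(1)] by (intro bexI[of _ "finv g"]) (auto simp: y_def)
qed

end

text \<open>The set \<open>F\<close> is thought of as the common fixed points of a normal subgroup. Then \<open>t\<close> is central in the
action of \<open>G\<close> on \<open>F\<close>, and its slope makes it contract towards \<open>a\<close>.\<close>

locale central_orbital = orbital +
  fixes F :: "real set" and t :: "real \<Rightarrow> real" and \<tau> :: real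
  assumes F_sub: "p \<in> F \<Longrightarrow> a < p \<and> p < b" and F_ne: "F \<noteq> {}"
    and F_inv: "g \<in> G \<Longrightarrow> p \<in> F \<Longrightarrow> g p \<in> F"
    and t_mem: "t \<in> G" and t_slope: "germ_slope t a 1 \<tau>" and \<tau>_less: "\<tau> < 1"
    and comm: "g \<in> G \<Longrightarrow> p \<in> F \<Longrightarrow> g (t p) = t (g p)"
begin

lemma F_near_a: "a < x \<Longrightarrow> \<exists>p\<in>F. p < x"
  using F_ne F_sub F_inv orbit_near_a by (metis all_not_in_conv)

lemma F_near_b: "x < b \<Longrightarrow> \<exists>p\<in>F. x < p"
  using F_ne F_sub F_inv orbit_near_b by (metis all_not_in_conv)

lemma slope_pos:
  assumes "g \<in> G" "germ_slope g c d m" "d \<noteq> 0"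
  shows "0 < m"
proof -
  obtain m' where "0 < m'" "germ_slope g c d m'" using PLH_germ[OF in_PLH[OF assms(1)]] .
  then show ?thesis using germ_slope_unique assms(2,3) by metis
qed

lemma \<tau>_pos: "0 < \<tau>" using slope_pos[OF t_mem t_slope] by simp

lemma t_linear:
  obtains e where "0 < e" "e \<le> b - a" "\<And>y. 0 \<le> y \<Longrightarrow> y \<le> e \<Longrightarrow> t (a + y) = a + \<tau> * y"
proof -
  obtain e where e: "0 < e" "e \<le> b - a"
      "\<And>y. 0 \<le> y \<Longrightarrow> y \<le> e \<Longrightarrow> t (a + 1 * y) = t a + \<tau> * 1 * y"
    using germ_slopeE[OF t_slope, of "b - a"] ab by auto
  then show ?thesis using fixes_a[OF t_mem] by (intro that[of e]) auto
qed

lemma pow_mem: "g \<in> G \<Longrightarrow> (g ^^ j) \<in> G"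
  by (induction j) (simp_all add: id_mem comp_mem del: o_apply)

lemmas t_pow_mem = pow_mem[OF t_mem]
lemmas inv_t_pow_mem = pow_mem[OF finv_mem[OF t_mem]]

lemma t_pow_F: "p \<in> F \<Longrightarrow> (t ^^ j) p \<in> F"
  using F_inv[OF t_pow_mem] .

lemma comm_pow: "g \<in> G \<Longrightarrow> p \<in> F \<Longrightarrow> g ((t ^^ j) p) = (t ^^ j) (g p)"
  by (induction j) (auto simp: comm t_pow_F)

lemma comm_inv: "g \<in> G \<Longrightarrow> p \<in> F \<Longrightarrow> g (finv t p) = finv t (g p)"
  using comm[of g "finv t p"] F_inv[OF finv_mem[OF t_mem], of p] PLH_f_inv[OF in_PLH[OF t_mem]]
    PLH_inv_f[OF in_PLH[OF t_mem]] by metis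

lemma inv_t_pow_F: "p \<in> F \<Longrightarrow> (finv t ^^ j) p \<in> F"
  using F_inv[OF inv_t_pow_mem] .

lemma comm_inv_pow: "g \<in> G \<Longrightarrow> p \<in> F \<Longrightarrow> g ((finv t ^^ j) p) = (finv t ^^ j) (g p)"
  by (induction j) (auto simp: comm_inv inv_t_pow_F)

text \<open>Close to \<open>a\<close> this is the linear contraction, and an arbitrary \<open>p\<close> can be moved there by some \<open>g\<close>,
which commutes with \<open>t\<close> on \<open>F\<close>.\<close>

lemma t_pow_to_a:
  assumes p: "p \<in> F" and x: "a < x"
  shows "\<exists>j. (t ^^ j) p < x"
proof -
  obtain e where e: "0 < e" "\<And>y. 0 \<le> y \<Longrightarrow> y \<le> e \<Longrightarrow> t (a + y) = a + \<tau> * y" using t_linear by blast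
  obtain g where g: "g \<in> G" "g p < a + e" using orbit_near_a[of p "a + e"] F_sub[OF p] e(1) by auto
  have gp: "a < g p" using F_sub[OF F_inv[OF g(1) p]] by simp
  have "a < g x" using interval_iff(1)[OF g(1)] x by simp
  then obtain j where j: "\<tau> ^ j * (g p - a) < g x - a"
    using power_times_small[OF \<tau>_pos \<tau>_less, of "g x - a"] by auto
  have "g ((t ^^ j) p) = (t ^^ j) (a + 1 * (g p - a))" using comm_pow[OF g(1) p] by simp
  also have "\<dots> = a + 1 * (\<tau> ^ j * (g p - a))"
    by (rule contraction_pow[of e]) (use e \<tau>_pos \<tau>_less gp g in auto)
  also have "\<dots> < g x" using j by simp
  finally show ?thesis using PLH_less_iff[OF in_PLH[OF g(1)]] by auto
qed

text \<open>The slope of \<open>g\<close> at \<open>a\<close> decides the direction in which \<open>g\<close> moves points of \<open>F\<close> close to \<open>a\<close>; a power of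
\<open>t\<close> moves every point of \<open>F\<close> there. In particular elements of slope 1 fix \<open>F\<close> pointwise.\<close>

lemma slope_sign:
  assumes g: "g \<in> G" "germ_slope g a 1 m" and p: "p \<in> F"
  shows "m < 1 \<Longrightarrow> g p < p" "m = 1 \<Longrightarrow> g p = p"
proof -
  obtain e where e: "0 < e" "\<And>y. 0 \<le> y \<Longrightarrow> y \<le> e \<Longrightarrow> g (a + 1 * y) = g a + m * 1 * y"
    using germ_slopeE[OF g(2), of 1] by auto
  obtain j where j: "(t ^^ j) p < a + e" using t_pow_to_a[OF p, of "a + e"] e(1) by auto
  define y where "y = (t ^^ j) p - a"
  have y: "0 < y" "y \<le> e" using j F_sub[OF t_pow_F[OF p]] by (auto simp: y_def)
  have "(t ^^ j) (g p) = g (a + y)" using comm_pow[OF g(1) p] by (simp add: y_def)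
  also have "\<dots> = a + m * y" using e(2)[of y] y fixes_a[OF g(1)] by simp
  finally have eq: "(t ^^ j) (g p) = a + m * y" .
  note tj = in_PLH[OF t_pow_mem[of j]]
  show "g p < p" if "m < 1"
  proof -
    have "m * y < 1 * y" using y that by (intro mult_strict_right_mono) auto
    then have "(t ^^ j) (g p) < (t ^^ j) p" using eq by (simp add: y_def)
    then show ?thesis using PLH_less_iff[OF tj] by simp
  qed
  show "g p = p" if "m = 1"
    using eq that PLH_eq_iff[OF tj] by (simp add: y_def)
qed

lemma t_decreases: "p \<in> F \<Longrightarrow> t p < p"
  using slope_sign(1)[OF t_mem t_slope _ \<tau>_less] .

lemma trivial_near_b:
  assumes g: "g \<in> G" "germ_slope g a 1 1"
  shows "germ_slope g b (-1) 1"
proof -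
  obtain m where m: "germ_slope g b (-1) m" using PLH_germ[OF in_PLH[OF g(1)]] .
  have "m = 1"
  proof (rule germ_slope_one_if_fixed_points_accumulate[OF m fixes_b[OF g(1)]])
    fix e :: real assume "0 < e"
    then obtain p where p: "p \<in> F" "b - e < p" using F_near_b[of "b - e"] by auto
    then show "\<exists>y. 0 < y \<and> y < e \<and> g (b + - 1 * y) = b + - 1 * y"
      using F_sub[OF p(1)] slope_sign(2)[OF g p(1)] by (intro exI[of _ "b - p"]) auto
  qed simp
  then show ?thesis using m by simp
qed

text \<open>Seen from \<open>b\<close> the contraction is the inverse of \<open>t\<close>, since \<open>t\<close> decreases the points of \<open>F\<close>.\<close>

lemma inv_t_linear:
  obtains e r where "0 < e" "e < b - a" "0 < r" "r < 1"
    "\<And>y. 0 \<le> y \<Longrightarrow> y \<le> e \<Longrightarrow> finv t (b - y) = b - r * y"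
proof -
  have it: "finv t \<in> G" using finv_mem[OF t_mem] .
  obtain r where r: "0 < r" "germ_slope (finv t) b (-1) r" using PLH_germ[OF in_PLH[OF it]] .
  obtain e where e: "0 < e" "e \<le> (b - a) / 2"
      "\<And>y. 0 \<le> y \<Longrightarrow> y \<le> e \<Longrightarrow> finv t (b + -1 * y) = finv t b + r * -1 * y"
    using germ_slopeE[OF r(2), of "(b - a) / 2"] ab by auto
  have lin: "finv t (b - y) = b - r * y" if "0 \<le> y" "y \<le> e" for y
    using e(3)[OF that] fixes_b[OF it] by simp
  obtain p where p: "p \<in> F" "b - e < p" using F_near_b[of "b - e"] e(1) by auto
  have "p < finv t p"
    using t_decreases[OF F_inv[OF it p(1)]] PLH_f_inv[OF in_PLH[OF t_mem]] by simp
  moreover have "finv t (b - (b - p)) = b - r * (b - p)" using p F_sub[OF p(1)] by (intro lin) auto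
  ultimately have "r * (b - p) < 1 * (b - p)" by simp
  then have "r < 1" using F_sub[OF p(1)] by (simp only: mult_less_cancel_right) linarith
  moreover have "e < b - a" using e(2) ab by simp
  ultimately show ?thesis using that e(1) r(1) lin by blast
qed

lemma inv_t_pow_to_b:
  assumes p: "p \<in> F" and x: "x < b"
  shows "\<exists>j. x < (finv t ^^ j) p"
proof -
  obtain e r where e: "0 < e" "e < b - a" "0 < r" "r < 1"
      "\<And>y. 0 \<le> y \<Longrightarrow> y \<le> e \<Longrightarrow> finv t (b - y) = b - r * y"
    by (rule inv_t_linear, rule that)
  obtain g where g: "g \<in> G" "b - e < g p" using orbit_near_b[of p "b - e"] F_sub[OF p] e(1) by auto
  have gp: "g p < b" using F_sub[OF F_inv[OF g(1) p]] by simp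
  have "g x < b" using interval_iff(2)[OF g(1)] x by simp
  then obtain j where j: "r ^ j * (b - g p) < b - g x"
    using power_times_small[OF e(3,4), of "b - g x"] by auto
  have "g ((finv t ^^ j) p) = (finv t ^^ j) (b + -1 * (b - g p))" using comm_inv_pow[OF g(1) p] by simp
  also have "\<dots> = b + -1 * (r ^ j * (b - g p))"
    by (rule contraction_pow[of e]) (use e gp g in auto)
  also have "\<dots> > g x" using j by simp
  finally show ?thesis using PLH_less_iff[OF in_PLH[OF g(1)]] by auto
qed

text \<open>Commutators have slope 1 at \<open>a\<close>. Hence any element of slope less than 1 can take the place of \<open>t\<close>.\<close>

lemma commutator_fixes_F:
  assumes "g \<in> G" "h \<in> G" "p \<in> F"
  shows "g (h p) = h (g p)"
proof -
  obtain m where m: "0 < m" "germ_slope g a 1 m" using PLH_germ[OF in_PLH[OF assms(1)]] .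
  obtain n where n: "0 < n" "germ_slope h a 1 n" using PLH_germ[OF in_PLH[OF assms(2)]] .
  define u where "u = finv (h \<circ> g) \<circ> (g \<circ> h)"
  have hg: "h \<circ> g \<in> G" "g \<circ> h \<in> G" using comp_mem assms by auto
  have s: "germ_slope (h \<circ> g) a 1 (n * m)" "germ_slope (g \<circ> h) a 1 (m * n)"
    using germ_slope_comp_fixed[OF m(2) n(2) m(1)] germ_slope_comp_fixed[OF n(2) m(2) n(1)] fixes_a assms by auto
  then have "germ_slope (finv (h \<circ> g)) a 1 (1 / (n * m))"
    using germ_slope_inv[OF PLH_bij[OF in_PLH[OF hg(1)]] s(1)] fixes_a[OF hg(1)] m n by simp
  from germ_slope_comp_fixed[OF s(2) this] have "germ_slope u a 1 (1 / (n * m) * (m * n))"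
    unfolding u_def using fixes_a[OF hg(2)] m n by simp
  then have "germ_slope u a 1 1" using m n by simp
  moreover have "u \<in> G" unfolding u_def using comp_mem finv_mem hg by blast
  ultimately have "u p = p" using slope_sign(2) assms(3) by blast
  then show ?thesis unfolding u_def using PLH_inv_eq_iff[OF in_PLH[OF hg(1)]] by simp
qed

end

section \<open>Discreteness of the slopes\<close>

locale closed_central_orbital = central_orbital +
  assumes F_closed: "a < x \<Longrightarrow> x < b \<Longrightarrow> (\<And>\<epsilon>. \<epsilon> > 0 \<Longrightarrow> \<exists>q\<in>F. \<bar>q - x\<bar> < \<epsilon>) \<Longrightarrow> x \<in> F"
begin

text \<open>Suppose there are slopes \<open>m < 1\<close> arbitrarily close to 1. On \<open>F\<close> near \<open>a\<close> an element of slope \<open>m\<close> is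
the scaling by \<open>m\<close>, so the closed set \<open>F\<close> contains an initial segment and by invariance \<open>F = (a, b)\<close>.
Now all of \<open>G\<close> commutes with \<open>t\<close>, so that every element of slope less than 1 is linear on fixed
neighbourhoods of \<open>a\<close> and \<open>b\<close>. A power \<open>\<psi>\<close> of \<open>t\<close> carries a point \<open>u\<close> near \<open>b\<close> to a point near \<open>a\<close>,
and it is affine on a small interval \<open>[u, u + \<delta>]\<close>. For \<open>m\<close> close to 1 the element \<open>g\<close> moves the right
half of this interval into the interval itself, where it is affine with fixed point \<open>b\<close> while its
conjugate by \<open>\<psi>\<close> is affine with fixed point \<open>a\<close>. So the affine extension of \<open>\<psi>\<close> would map \<open>b\<close> to \<open>a\<close>,
although it is increasing with values above \<open>a\<close> on the interval.\<close>

lemma slopes_bounded_away_from_one: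
  "\<exists>L<1. \<forall>g\<in>G. \<forall>m. germ_slope g a 1 m \<longrightarrow> m < 1 \<longrightarrow> m \<le> L"
proof (rule ccontr)
  assume "\<not> ?thesis"
  then have dense: "\<exists>g\<in>G. \<exists>m. germ_slope g a 1 m \<and> m < 1 \<and> L < m" if "L < 1" for L
    using that by (meson not_le)
  obtain e where e: "0 < e" "e \<le> b - a" "\<And>y. 0 \<le> y \<Longrightarrow> y \<le> e \<Longrightarrow> t (a + y) = a + \<tau> * y"
    using t_linear by blast
  have lin: "g p = a + m * (p - a)" if "g \<in> G" "germ_slope g a 1 m" "m < 1" "p \<in> F" "p \<le> a + e" for g m p
  proof -
    have "g p < p" using slope_sign(1) that by blast
    moreover have "a < g p" "a < p" using F_sub F_inv that by blast+
    moreover have "g ((t ^^ j) (a + 1 * (p - a))) = (t ^^ j) (g (a + 1 * (p - a)))" for j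
      using comm_pow[OF that(1,4)] by simp
    ultimately have "g p - a = m * (p - a)"
      using that(5) e \<tau>_pos \<tau>_less
      by (intro linear_if_commutes_with_contraction[of e t a 1 \<tau> g m "p - a" "g p - a", OF _ _ _ that(2) fixes_a[OF that(1)]])
        simp_all
    then show ?thesis by simp
  qed
  obtain p where p: "p \<in> F" "p < a + e" using F_near_a[of "a + e"] e by auto
  have iter: "(g ^^ j) p = a + m ^ j * (p - a)" if g: "g \<in> G" "germ_slope g a 1 m" "m < 1" for g m j
  proof (induction j)
    case (Suc j)
    have "0 < m" using slope_pos[OF g(1,2)] by simp
    have "m ^ j * (p - a) \<le> 1 * (p - a)"
      by (rule mult_right_mono[OF power_le_one]) (use g \<open>0 < m\<close> F_sub[OF p(1)] in auto)
    then have "(g ^^ j) p \<le> a + e" using Suc p by simp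
    then have "g ((g ^^ j) p) = a + m * ((g ^^ j) p - a)" using lin[OF g F_inv[OF pow_mem[OF g(1)] p(1)]] by blast
    then show ?case using Suc by (simp add: mult.assoc)
  qed simp
  have initial: "x \<in> F" if x: "a < x" "x < p" for x
  proof (rule F_closed)
    fix \<epsilon> :: real assume "0 < \<epsilon>"
    have pa: "0 < p - a" using F_sub[OF p(1)] by simp
    then obtain g m where g: "g \<in> G" "germ_slope g a 1 m" "m < 1" "1 - \<epsilon> / (p - a) < m"
      using dense[of "1 - \<epsilon> / (p - a)"] \<open>0 < \<epsilon>\<close> by auto
    have "0 < m" using slope_pos[OF g(1,2)] by simp
    \<comment> \<open>the orbit of \<open>p\<close> under \<open>g\<close> descends in steps shorter than \<open>\<epsilon>\<close>, so its first point below \<open>x\<close> is close to \<open>x\<close>\<close>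
    define j where "j = (LEAST j. m ^ j * (p - a) < x - a)"
    have "\<exists>j. m ^ j * (p - a) < x - a" using power_times_small[OF \<open>0 < m\<close> g(3)] x by simp
    then have j: "m ^ j * (p - a) < x - a" unfolding j_def by (rule LeastI_ex)
    then have "j \<noteq> 0" using x by (intro notI) simp
    then obtain i where i: "j = Suc i" using not0_implies_Suc by blast
    then have mi: "x - a \<le> m ^ i * (p - a)" using not_less_Least[of i "\<lambda>j. m ^ j * (p - a) < x - a"]
      unfolding j_def[symmetric] by simp
    have "\<epsilon> > (1 - m) * (p - a)" using g(4) pa by (simp add: field_simps)
    moreover have "m ^ i * ((1 - m) * (p - a)) \<le> 1 * ((1 - m) * (p - a))"
      by (rule mult_right_mono[OF power_le_one]) (use g \<open>0 < m\<close> pa in auto)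
    ultimately have "m ^ i * (p - a) - m ^ j * (p - a) < \<epsilon>" unfolding i by (simp add: algebra_simps)
    then have "\<bar>(g ^^ j) p - x\<bar> < \<epsilon>" using iter[OF g(1-3), of j] j mi by (auto simp: abs_if)
    then show "\<exists>q\<in>F. \<bar>q - x\<bar> < \<epsilon>" using F_inv[OF pow_mem[OF g(1)] p(1)] by blast
  qed (use x F_sub[OF p(1)] in auto)
  have F_all: "x \<in> F" if x: "a < x" "x < b" for x
  proof -
    obtain g where g: "g \<in> G" "g x < p" using orbit_near_a[OF x] F_sub[OF p(1)] by blast
    then have "g x \<in> F" using initial interval_iff(1)[OF g(1)] x by simp
    then show ?thesis using F_inv[OF finv_mem[OF g(1)]] PLH_inv_f[OF in_PLH[OF g(1)]] by metis
  qed
  obtain e' r where e': "0 < e'" "e' < b - a" "0 < r" "r < 1"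
      "\<And>y. 0 \<le> y \<Longrightarrow> y \<le> e' \<Longrightarrow> finv t (b - y) = b - r * y"
    using inv_t_linear by blast
  define u where "u = b - e'"
  have u: "a < u" "u < b" "u \<in> F" using e' by (auto simp: u_def intro!: F_all)
  obtain j where j: "(t ^^ j) u < a + e" using t_pow_to_a[OF u(3), of "a + e"] e by auto
  define \<psi> where "\<psi> = t ^^ j"
  have \<psi>: "\<psi> \<in> G" "\<psi> u < a + e" "a < \<psi> u"
    using t_pow_mem j interval_iff(1)[OF t_pow_mem] u by (auto simp: \<psi>_def)
  obtain \<alpha> where \<alpha>: "0 < \<alpha>" "germ_slope \<psi> u 1 \<alpha>" using PLH_germ[OF in_PLH[OF \<psi>(1)]] .
  obtain \<delta> where \<delta>: "0 < \<delta>" "\<delta> \<le> min (e' / 2) ((a + e - \<psi> u) / \<alpha>)"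
      "\<And>y. 0 \<le> y \<Longrightarrow> y \<le> \<delta> \<Longrightarrow> \<psi> (u + 1 * y) = \<psi> u + \<alpha> * 1 * y"
    using germ_slopeE[OF \<alpha>(2), of "min (e' / 2) ((a + e - \<psi> u) / \<alpha>)"] e' \<psi> \<alpha> by auto
  have \<delta>': "\<delta> < e'" "\<alpha> * \<delta> \<le> a + e - \<psi> u" using \<delta>(1,2) \<alpha>(1) e'(1)
    by (auto simp: pos_le_divide_eq mult.commute)
  define A where "A = \<psi> u - a"
  have A: "0 < A" using \<psi> by (simp add: A_def)
  have A': "0 < A + \<alpha> * (\<delta> / 2)" using A \<alpha>(1) \<delta>(1) by (intro add_pos_pos mult_pos_pos) auto
  have "A / (A + \<alpha> * (\<delta> / 2)) < 1" unfolding divide_less_eq_1_pos[OF A'] using \<alpha>(1) \<delta>(1) by simp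
  then obtain g \<mu> where g: "g \<in> G" "germ_slope g a 1 \<mu>" "\<mu> < 1" "A / (A + \<alpha> * (\<delta> / 2)) < \<mu>"
    using dense by blast
  have "0 < \<mu>" using slope_pos[OF g(1,2)] by simp
  obtain \<nu> where \<nu>: "0 < \<nu>" "germ_slope g b (-1) \<nu>" using PLH_germ[OF in_PLH[OF g(1)]] .
  \<comment> \<open>the two descriptions of \<open>\<psi> (g (u + y))\<close>, one from the linearity of \<open>g\<close> at \<open>b\<close> and one from that at \<open>a\<close>\<close>
  have key: "A + \<alpha> * (e' - \<nu> * (e' - y)) = \<mu> * (A + \<alpha> * y)" if y: "\<delta> / 2 \<le> y" "y \<le> \<delta>" for y
  proof -
    define x where "x = u + y"
    have x: "a < x" "x < b" "x \<in> F" using y u \<delta>' \<delta>(1) by (auto simp: x_def u_def intro!: F_all)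
    have \<psi>x: "\<psi> x = a + (A + \<alpha> * y)" using \<delta>(3)[of y] y \<delta>(1) by (simp add: x_def A_def)
    have "\<alpha> * y \<le> \<alpha> * \<delta>" using y \<alpha>(1) by simp
    then have "\<psi> x \<le> a + e" using \<psi>x \<delta>'(2) by (simp add: A_def)
    then have "g (\<psi> x) = a + \<mu> * (A + \<alpha> * y)"
      using lin[OF g(1-3) F_inv[OF \<psi>(1) x(3)]] \<psi>x by simp
    then have \<psi>gx: "\<psi> (g x) = a + \<mu> * (A + \<alpha> * y)"
      using comm_pow[OF g(1) x(3)] by (simp add: \<psi>_def)
    have "A < \<mu> * (A + \<alpha> * (\<delta> / 2))" using g(4) unfolding pos_divide_less_eq[OF A'] .
    also have "\<dots> \<le> \<mu> * (A + \<alpha> * y)" using y \<alpha>(1) \<open>0 < \<mu>\<close> by (intro mult_left_mono) auto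
    finally have "\<psi> u < \<psi> (g x)" using \<psi>gx by (simp add: A_def)
    then have gx: "u < g x" using PLH_less_iff[OF in_PLH[OF \<psi>(1)]] by simp
    have gxx: "g x < x" using slope_sign(1)[OF g(1,2) x(3) g(3)] .
    have "g ((finv t ^^ j) (b + -1 * (b - x))) = (finv t ^^ j) (g (b + -1 * (b - x)))" for j
      using comm_inv_pow[OF g(1) x(3)] by simp
    moreover have "0 \<le> b - x" "b - x \<le> e'" "0 \<le> b - g x" "b - g x \<le> e'"
      using gx gxx x y \<delta>(1) by (auto simp: x_def u_def)
    ultimately have "b - g x = \<nu> * (b - x)"
      using e' by (intro linear_if_commutes_with_contraction
          [of e' "finv t" b "-1" r g \<nu> "b - x" "b - g x", OF _ _ _ \<nu>(2) fixes_b[OF g(1)]]) simp_all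
    then have "g x = u + (e' - \<nu> * (e' - y))" by (simp add: x_def u_def algebra_simps)
    moreover have "\<psi> (u + 1 * (g x - u)) = \<psi> u + \<alpha> * 1 * (g x - u)"
      by (rule \<delta>(3)) (use gx gxx y in \<open>auto simp: x_def\<close>)
    ultimately show ?thesis using \<psi>gx by (simp add: A_def)
  qed
  have k1: "A + \<alpha> * (e' - \<nu> * (e' - \<delta>)) = \<mu> * (A + \<alpha> * \<delta>)" using key[of \<delta>] \<delta>(1) by simp
  have k2: "A + \<alpha> * (e' - \<nu> * (e' - \<delta> / 2)) = \<mu> * (A + \<alpha> * (\<delta> / 2))" using key[of "\<delta> / 2"] \<delta>(1) by simp
  have "\<nu> * (\<alpha> * (\<delta> / 2)) = \<mu> * (A + \<alpha> * \<delta>) - \<mu> * (A + \<alpha> * (\<delta> / 2))"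
    unfolding k1[symmetric] k2[symmetric] by (simp add: field_simps)
  also have "\<dots> = \<mu> * (\<alpha> * (\<delta> / 2))" by (simp add: field_simps)
  finally have "\<nu> * (\<alpha> * (\<delta> / 2)) = \<mu> * (\<alpha> * (\<delta> / 2))" .
  then have "\<nu> = \<mu>" using \<alpha>(1) \<delta>(1) by simp
  have "A + \<alpha> * e' - \<mu> * (A + \<alpha> * e') = (A + \<alpha> * (e' - \<nu> * (e' - \<delta>))) - \<mu> * (A + \<alpha> * \<delta>)"
    unfolding \<open>\<nu> = \<mu>\<close> by (simp add: algebra_simps)
  then have "A + \<alpha> * e' = \<mu> * (A + \<alpha> * e')" unfolding k1 by simp
  moreover have "\<mu> * (A + \<alpha> * e') < 1 * (A + \<alpha> * e')"
    using g(3) A \<alpha>(1) e'(1) by (intro mult_strict_right_mono add_pos_pos mult_pos_pos) auto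
  ultimately show False by (metis mult_1 order_less_irrefl)
qed

lemma slope_generator:
  obtains s l where "s \<in> G" "germ_slope s a 1 l" "l < 1" 
    "\<And>g m. g \<in> G \<Longrightarrow> germ_slope g a 1 m \<Longrightarrow> \<exists>k::int. m = l powi k"
proof -
  define S where "S = {m. \<exists>g\<in>G. germ_slope g a 1 m}"
  have pos: "0 < m" if "m \<in> S" for m using that slope_pos unfolding S_def by fastforce
  obtain L where L: "L < 1" "\<And>g m. g \<in> G \<Longrightarrow> germ_slope g a 1 m \<Longrightarrow> m < 1 \<Longrightarrow> m \<le> L"
    using slopes_bounded_away_from_one by blast
  have "\<exists>l\<in>S. l < 1 \<and> (\<forall>m\<in>S. \<exists>k::int. m = l powi k)"
  proof (rule discrete_multiplicative_subgroup_cyclic[OF pos _ _ _ \<tau>_less L(1)])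
    show "\<tau> \<in> S" using t_mem t_slope by (auto simp: S_def)
    show "m \<le> L" if "m \<in> S" "m < 1" for m using that L(2) by (auto simp: S_def)
    show "m * n \<in> S" if mn: "m \<in> S" "n \<in> S" for m n
    proof -
      obtain g h where "g \<in> G" "germ_slope g a 1 m" "h \<in> G" "germ_slope h a 1 n"
        using mn by (auto simp: S_def)
      then show ?thesis unfolding S_def
        using germ_slope_comp_fixed[of h a 1 n g m] pos[OF mn(2)] fixes_a comp_mem by blast
    qed
    show "1 / m \<in> S" if m: "m \<in> S" for m
    proof -
      obtain g where g: "g \<in> G" "germ_slope g a 1 m" using m by (auto simp: S_def)
      then have "germ_slope (finv g) a 1 (1 / m)"
        using germ_slope_inv[OF PLH_bij[OF in_PLH[OF g(1)]] g(2) pos[OF m]] fixes_a[OF g(1)] by simp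
      then show ?thesis unfolding S_def using finv_mem[OF g(1)] by blast
    qed
  qed blast+
  then obtain l where l: "l \<in> S" "l < 1" "\<forall>m\<in>S. \<exists>k::int. m = l powi k" by blast
  then obtain s where "s \<in> G" "germ_slope s a 1 l" by (auto simp: S_def)
  then show ?thesis using that[of s l] l(2,3) unfolding S_def by blast
qed

end

section \<open>A central element modulo the common fixed points\<close>

text \<open>A strictly increasing map that moved \<open>x\<close> upwards would move all points near \<open>x\<close> upwards too.\<close>

lemma fixed_points_closed:
  assumes f: "f \<in> carrier PLH" and lim: "\<And>\<epsilon>. \<epsilon> > 0 \<Longrightarrow> \<exists>q. f q = q \<and> \<bar>q - x\<bar> < \<epsilon>"
  shows "f x = x"
proof -
  have no_increase: "\<not> x < g x"
    if g: "g \<in> carrier PLH" and lim: "\<And>\<epsilon>. \<epsilon> > 0 \<Longrightarrow> \<exists>q. g q = q \<and> \<bar>q - x\<bar> < \<epsilon>" for g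
  proof
    assume "x < g x"
    then have "g (finv g x) < g x" using PLH_f_inv[OF g] by simp
    then have "finv g x < x" using PLH_less_iff[OF g] by simp
    obtain q where q: "g q = q" "\<bar>q - x\<bar> < min (g x - x) (x - finv g x)"
      using lim[of "min (g x - x) (x - finv g x)"] \<open>x < g x\<close> \<open>finv g x < x\<close> by auto
    then have "q < g x" "finv g x < q" by auto
    then have "g (finv g x) < g q" using PLH_less_iff[OF g] by blast
    then have "x < q" using PLH_f_inv[OF g] q(1) by simp
    then have "g x < g q" using PLH_less_iff[OF g] by blast
    then show False using \<open>q < g x\<close> q(1) by simp
  qed
  have "\<not> x < f x" using no_increase[OF f lim] .
  moreover have "\<not> x < finv f x"
    using no_increase[OF inv_mem_PLH[OF f]] lim PLH_inv_eq_iff[OF f] by metis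
  then have "\<not> f x < f (finv f x)" using PLH_less_iff[OF f] by simp
  ultimately show ?thesis using PLH_f_inv[OF f] by simp
qed

text \<open>Conjugation by \<open>g\<close> is a homomorphism, and homomorphic images commute with the derived series.\<close>

lemma conjugation_preserves_derived_series:
  assumes G: "subgroup G PLH" and g: "g \<in> G" and f: "f \<in> (derived PLH ^^ i) G"
  shows "g \<circ> f \<circ> finv g \<in> (derived PLH ^^ i) G"
proof -
  note G' = subgroup_PLH_D[OF G]
  let ?c = "\<lambda>f. g \<circ> f \<circ> finv g"
  have "?c \<in> hom PLH PLH"
    by (rule homI) (use G'(1)[OF g] in \<open>auto intro: comp_mem_PLH inv_mem_PLH simp: fun_eq_iff\<close>)
  then interpret c: group_hom PLH PLH ?c
    by (simp add: group_hom_def group_hom_axioms_def group_PLH)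
  have "?c ` G \<subseteq> G" using G'(3,4) g by blast
  then have "?c ` ((derived PLH ^^ i) G) \<subseteq> (derived PLH ^^ i) G"
    using c.exp_of_derived_img[OF subgroup.subset[OF G], of i] PLH.mono_exp_of_derived by metis
  then show ?thesis using f by blast
qed

lemma commutator_mem_derived:
  assumes "f \<in> N" "h \<in> N" "N \<subseteq> carrier PLH"
  shows "f \<circ> h \<circ> finv f \<circ> finv h \<in> derived PLH N"
proof -
  have "f \<circ> h \<circ> finv f \<circ> finv h = f \<otimes>\<^bsub>PLH\<^esub> h \<otimes>\<^bsub>PLH\<^esub> inv\<^bsub>PLH\<^esub> f \<otimes>\<^bsub>PLH\<^esub> inv\<^bsub>PLH\<^esub> h"
    using assms inv_PLH[of f] inv_PLH[of h] by (simp add: subset_iff)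
  then have "f \<circ> h \<circ> finv f \<circ> finv h \<in> derived_set PLH N" using assms(1,2) by blast
  then show ?thesis unfolding derived_def by (rule generate.incl)
qed

context orbital
begin

text \<open>Let \<open>N\<close> be the last term of the derived series that has no fixed point in \<open>(a, b)\<close>; on the fixed points
\<open>F\<close> of \<open>N'\<close> it acts commutatively. If \<open>f \<in> N\<close> has slope 1 at \<open>a\<close>, it fixes the points of \<open>F\<close> near \<open>a\<close>,
and every point of \<open>F\<close> is carried there by an element of \<open>N\<close>, which commutes with \<open>f\<close>; so \<open>f\<close> fixes
\<open>F\<close>. Hence an element that moves a point of \<open>F\<close> has slope different from 1, and it or its inverse
serves as \<open>t\<close>. For \<open>g \<in> G\<close> the commutator of \<open>g\<close> and \<open>t\<close> lies in the normal subgroup \<open>N\<close> and has slope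
1, so it fixes \<open>F\<close> too.\<close>

lemma ex_closed_central_orbital:
  assumes n: "(derived PLH ^^ n) G \<subseteq> {id}"
  obtains F t \<tau> where "closed_central_orbital G a b F t \<tau>"
proof -
  define D where "D i = (derived PLH ^^ i) G" for i
  define fixing where "fixing i \<longleftrightarrow> (\<exists>x. a < x \<and> x < b \<and> (\<forall>f\<in>D i. f x = x))" for i
  have "\<not> fixing 0" using moves by (auto simp: fixing_def D_def)
  moreover have "fixing n"
  proof -
    obtain x where "a < x" "x < b" using dense[OF ab] by blast
    then show ?thesis using n unfolding fixing_def D_def by (intro exI[of _ x]) auto
  qed
  ultimately obtain i where i: "\<not> fixing i" "fixing (Suc i)"
    using ex_least_nat_less[of fixing n] by auto
  have sub: "subgroup (D j) PLH" for j unfolding D_def by (rule PLH.exp_of_derived_is_subgroup[OF G])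
  have subG: "D j \<subseteq> G" for j unfolding D_def
    by (induction j) (use PLH.derived_incl[OF _ G] in auto)
  have norm: "g \<circ> f \<circ> finv g \<in> D j" if "g \<in> G" "f \<in> D j" for g f j
    using conjugation_preserves_derived_series[OF G] that unfolding D_def by blast
  interpret N: orbital "D i" a b
  proof (rule orbital.intro)
    show "subgroup (D i) PLH" by (rule sub)
    show "a < b" by (rule ab)
    show "g a = a" "g b = b" if "g \<in> D i" for g using that subG fixes_a fixes_b by auto
    show "\<exists>g\<in>D i. g x \<noteq> x" if "a < x" "x < b" for x using i(1) that by (auto simp: fixing_def)
  qed
  define F where "F = {x. a < x \<and> x < b \<and> (\<forall>f\<in>D (Suc i). f x = x)}"
  have F_sub: "a < p" "p < b" if "p \<in> F" for p using that by (auto simp: F_def)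
  have F_inv: "g p \<in> F" if g: "g \<in> G" and p: "p \<in> F" for g p
  proof -
    have "f (g p) = g p" if f: "f \<in> D (Suc i)" for f
    proof -
      have "finv g \<circ> f \<circ> finv (finv g) \<in> D (Suc i)" using norm[OF finv_mem[OF g] f] .
      then have "finv g (f (finv (finv g) p)) = p" using p by (auto simp: F_def)
      moreover have "finv (finv g) = g" using PLH_bij[OF in_PLH[OF g]] by (simp add: inv_inv_eq)
      ultimately show ?thesis using PLH_f_inv[OF in_PLH[OF g]] by metis
    qed
    then show ?thesis using interval_iff[OF g] F_sub[OF p] by (simp add: F_def)
  qed
  have F_invN: "f p \<in> F" if "f \<in> D i" "p \<in> F" for f p using F_inv that subG by blast
  have comm: "f (h p) = h (f p)" if f: "f \<in> D i" and h: "h \<in> D i" and p: "p \<in> F" for f h p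
  proof -
    have "f \<circ> h \<circ> finv f \<circ> finv h \<in> D (Suc i)"
      using commutator_mem_derived[OF f h] sub[of i] subgroup.subset by (auto simp: D_def)
    moreover have "h (f p) \<in> F" using F_invN f h p by blast
    ultimately have "(f \<circ> h \<circ> finv f \<circ> finv h) (h (f p)) = h (f p)" by (auto simp: F_def)
    then show ?thesis using N.in_PLH f h by simp
  qed
  have flat: "f q = q" if f: "f \<in> D i" "germ_slope f a 1 1" and q: "q \<in> F" for f q
  proof -
    obtain x where x: "a < x" "\<And>y. a \<le> y \<Longrightarrow> y \<le> x \<Longrightarrow> f y = y"
      using germ_slope_one_right[OF f(2) N.fixes_a[OF f(1)]] by blast
    obtain h where h: "h \<in> D i" "h q < x" using N.orbit_near_a[OF F_sub[OF q] x(1)] by blast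
    have "f (h q) = h q" using x(2)[of "h q"] h F_sub(1)[OF F_invN[OF h(1) q]] by simp
    then show ?thesis using comm[OF f(1) h(1) q] PLH_eq_iff[OF N.in_PLH[OF h(1)]] by simp
  qed
  obtain p where p: "p \<in> F" using i(2) by (auto simp: fixing_def F_def)
  obtain f where f: "f \<in> D i" "f p \<noteq> p" using N.moves[OF F_sub[OF p]] by blast
  obtain m where m: "0 < m" "germ_slope f a 1 m" using PLH_germ[OF N.in_PLH[OF f(1)]] .
  have "m \<noteq> 1" using flat[OF f(1) _ p] m f(2) by blast
  obtain t \<tau> where t: "t \<in> D i" "0 < \<tau>" "germ_slope t a 1 \<tau>" "\<tau> < 1"
  proof (cases "m < 1")
    case True then show ?thesis using that f(1) m by blast
  next
    case False
    have "germ_slope (finv f) a 1 (1 / m)"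
      using germ_slope_inv[OF PLH_bij[OF N.in_PLH[OF f(1)]] m(2,1)] N.fixes_a[OF f(1)] by simp
    then show ?thesis using that[of "finv f" "1 / m"] N.finv_mem[OF f(1)] False \<open>m \<noteq> 1\<close> by simp
  qed
  have tG: "t \<in> G" using t(1) subG by blast
  have it: "germ_slope (finv t) a 1 (1 / \<tau>)"
    using germ_slope_inv[OF PLH_bij[OF in_PLH[OF tG]] t(3,2)] fixes_a[OF tG] by simp
  have commG: "g (t q) = t (g q)" if g: "g \<in> G" and q: "q \<in> F" for g q
  proof -
    obtain m where m: "0 < m" "germ_slope g a 1 m" using PLH_germ[OF in_PLH[OF g]] .
    have ig: "germ_slope (finv g) a 1 (1 / m)"
      using germ_slope_inv[OF PLH_bij[OF in_PLH[OF g]] m(2,1)] fixes_a[OF g] by simp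
    let ?u = "g \<circ> (t \<circ> (finv g \<circ> finv t))"
    have "germ_slope (finv g \<circ> finv t) a 1 (1 / m * (1 / \<tau>))"
      using germ_slope_comp_fixed[OF it ig] t(2) fixes_a[OF finv_mem[OF tG]] by simp
    from germ_slope_comp_fixed[OF this t(3)]
    have "germ_slope (t \<circ> (finv g \<circ> finv t)) a 1 (\<tau> * (1 / m * (1 / \<tau>)))"
      using m(1) t(2) fixes_a[OF finv_mem[OF tG]] fixes_a[OF finv_mem[OF g]] by simp
    from germ_slope_comp_fixed[OF this m(2)]
    have "germ_slope ?u a 1 (m * (\<tau> * (1 / m * (1 / \<tau>))))"
      using m(1) t(2) fixes_a[OF finv_mem[OF tG]] fixes_a[OF finv_mem[OF g]] fixes_a[OF tG] by simp
    then have "germ_slope ?u a 1 1" using m(1) t(2) by simp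
    moreover have "?u \<in> D i"
      using N.comp_mem[OF norm[OF g t(1)] N.finv_mem[OF t(1)]] by (simp add: comp_assoc)
    moreover have "t (g q) \<in> F" using F_inv tG g q by blast
    ultimately have "?u (t (g q)) = t (g q)" using flat by blast
    then show ?thesis using in_PLH tG g by simp
  qed
  have "closed_central_orbital G a b F t \<tau>"
  proof
    show "x \<in> F" if "a < x" "x < b" "\<And>\<epsilon>. 0 < \<epsilon> \<Longrightarrow> \<exists>q\<in>F. \<bar>q - x\<bar> < \<epsilon>" for x
    proof -
      have "f x = x" if f: "f \<in> D (Suc i)" for f
      proof (rule fixed_points_closed)
        show "f \<in> carrier PLH" using f subG in_PLH by blast
        show "\<exists>q. f q = q \<and> \<bar>q - x\<bar> < \<epsilon>" if "\<epsilon> > 0" for \<epsilon>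
          using \<open>\<And>\<epsilon>. 0 < \<epsilon> \<Longrightarrow> \<exists>q\<in>F. \<bar>q - x\<bar> < \<epsilon>\<close>[OF that] f by (auto simp: F_def)
      qed
      then show ?thesis using that by (simp add: F_def)
    qed
  qed (use F_sub p F_inv tG t commG in auto)
  then show ?thesis by (rule that)
qed

end

section \<open>One orbital as a subgroup of a wreath product\<close>

text \<open>The group generated by the slope \<open>l\<close> of \<open>s\<close> contains all slopes at \<open>a\<close>.\<close>

locale cyclic_orbital = central_orbital G a b F s l for G a b F s l +
  assumes generator: "g \<in> G \<Longrightarrow> germ_slope g a 1 m \<Longrightarrow> \<exists>k::int. m = l powi k"
begin

text \<open>The powers of \<open>s\<close>, applied to points.\<close>

definition sp :: "int \<Rightarrow> real \<Rightarrow> real" where "sp k = s [^]\<^bsub>PLH\<^esub> k"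

lemma sp_0 [simp]: "sp 0 x = x" by (simp add: sp_def)

lemma sp_sp [simp]: "sp i (sp j x) = sp (i + j) x"
  using PLH.int_pow_mult[OF in_PLH[OF t_mem], of i j] by (simp add: sp_def)

lemma sp_int: "sp (int j) = s ^^ j"
proof (induction j)
  case 0 then show ?case by (simp add: sp_def)
next
  case (Suc j)
  have "sp (int (Suc j)) = sp (int j) \<circ> s"
    unfolding sp_def int_pow_int using PLH.nat_pow_Suc by simp
  then show ?case using Suc by (simp add: funpow_Suc_right del: funpow.simps)
qed

lemma sp_1: "sp 1 = s" using sp_int[of 1] by simp

lemma sp_neg_int: "sp (- int j) = finv s ^^ j"
proof
  fix x
  have "(s ^^ j) ((finv s ^^ j) x) = x"
  proof (induction j)
    case (Suc j)
    have "(s ^^ Suc j) ((finv s ^^ Suc j) x) = (s ^^ j) (s (finv s ((finv s ^^ j) x)))"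
      by (subst funpow_Suc_right) simp
    then show ?case using Suc PLH_f_inv[OF in_PLH[OF t_mem]] by simp
  qed simp
  then have "sp (- int j) (sp (int j) ((finv s ^^ j) x)) = sp (- int j) x" by (simp add: sp_int)
  then show "sp (- int j) x = (finv s ^^ j) x" by simp
qed

lemma sp_mem: "sp k \<in> G"
proof (cases "0 \<le> k")
  case True then show ?thesis using sp_int[of "nat k"] pow_mem[OF t_mem] by simp
next
  case False then show ?thesis using sp_neg_int[of "nat (- k)"] pow_mem[OF finv_mem[OF t_mem]] by simp
qed

lemma sp_less_iff [simp]: "sp k x < sp k y \<longleftrightarrow> x < y" and sp_le_iff [simp]: "sp k x \<le> sp k y \<longleftrightarrow> x \<le> y"
  using PLH_less_iff[OF in_PLH[OF sp_mem]] PLH_le_iff[OF in_PLH[OF sp_mem]] by blast+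

lemma finv_sp: "finv (sp k) = sp (- k)"
  by (rule ext) (simp add: PLH_inv_eq_iff[OF in_PLH[OF sp_mem]])

lemma sp_antimono: 
  assumes "q \<in> F" "i \<le> j" shows "sp j q \<le> sp i q"
proof -
  have "sp (i + int k) q \<le> sp i q" for k
  proof (induction k)
    case (Suc k)
    have "sp 1 (sp (i + int k) q) < sp (i + int k) q"
      unfolding sp_1 by (rule t_decreases) (rule F_inv[OF sp_mem assms(1)])
    then show ?case using Suc by (simp add: algebra_simps)
  qed simp
  from this[of "nat (j - i)"] show ?thesis using assms(2) by simp
qed

lemma l_powi_inject: "l powi i = l powi j \<longleftrightarrow> i = j"
  using \<tau>_pos \<tau>_less power_int_strict_decreasing[of i j l] power_int_strict_decreasing[of j i l]
  by (cases i j rule: linorder_cases) auto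

text \<open>The homomorphism to the integers with kernel \<open>K\<close>, namely the logarithm of the slope at \<open>a\<close> to the base \<open>l\<close>.\<close>

definition expo :: "(real \<Rightarrow> real) \<Rightarrow> int" where
  "expo g = (THE k. germ_slope g a 1 (l powi k))"

lemma expo_eq_iff:
  assumes "g \<in> G" shows "expo g = k \<longleftrightarrow> germ_slope g a 1 (l powi k)"
proof -
  obtain m where "germ_slope g a 1 m" using PLH_germ[OF in_PLH[OF assms]] by metis
  then obtain i where i: "germ_slope g a 1 (l powi i)" using generator[OF assms] by blast
  have uniq: "j = i" if "germ_slope g a 1 (l powi j)" for j
    using germ_slope_unique[OF that i] l_powi_inject by simp
  have "expo g = i" unfolding expo_def
  proof (rule the_equality)
    show "germ_slope g a 1 (l powi i)" by (rule i)
  qed (rule uniq)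
  then show ?thesis using i uniq by blast
qed

lemma germ_expo: "g \<in> G \<Longrightarrow> germ_slope g a 1 (l powi expo g)"
  using expo_eq_iff by blast

lemma expo_comp:
  assumes "g \<in> G" "h \<in> G" shows "expo (g \<circ> h) = expo g + expo h"
proof -
  have "0 < l powi expo h" using \<tau>_pos by simp
  from germ_slope_comp_fixed[OF germ_expo[OF assms(2)] germ_expo[OF assms(1)] this fixes_a[OF assms(2)]]
  have "germ_slope (g \<circ> h) a 1 (l powi (expo g + expo h))"
    using power_int_add[of l "expo g" "expo h"] \<tau>_pos by simp
  then show ?thesis using expo_eq_iff[OF comp_mem[OF assms]] by blast
qed

lemma expo_id: "expo id = 0" using expo_comp[OF id_mem id_mem] by simp

lemma expo_finv: 
  assumes "g \<in> G" shows "expo (finv g) = - expo g"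
proof -
  have "g \<circ> finv g = id" using PLH_f_inv[OF in_PLH[OF assms]] by (simp add: fun_eq_iff)
  then show ?thesis using expo_comp[OF assms finv_mem[OF assms]] expo_id by simp
qed

lemma expo_s: "expo s = 1" using expo_eq_iff[OF t_mem, of 1] t_slope by simp

lemma expo_sp: "expo (sp k) = k"
proof -
  have nat: "expo (sp (int j)) = int j" for j
    unfolding sp_int
  proof (induction j)
    case 0 show ?case using expo_id by (simp add: id_def)
  next
    case (Suc j) then show ?case using expo_comp[OF t_mem pow_mem[OF t_mem], of j] expo_s by (simp add: comp_def)
  qed
  show ?thesis
  proof (cases "0 \<le> k")
    case True then show ?thesis using nat[of "nat k"] by simp
  next
    case False
    then show ?thesis using nat[of "nat (- k)"] expo_finv[OF sp_mem, of "- k"] by (simp add: finv_sp)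
  qed
qed

definition K :: "(real \<Rightarrow> real) set" where "K = {g \<in> G. expo g = 0}"

lemma K_sub: "k \<in> K \<Longrightarrow> k \<in> G" by (simp add: K_def)

lemma subgroup_K: "subgroup K PLH"
  by (rule subgroup_PLH_I)
    (auto simp: K_def in_PLH id_mem comp_mem finv_mem expo_id expo_comp expo_finv)

lemma K_flat: "k \<in> K \<Longrightarrow> germ_slope k a 1 1"
  using germ_expo by (fastforce simp: K_def)

lemma K_fixes_F: "k \<in> K \<Longrightarrow> q \<in> F \<Longrightarrow> k q = q"
  using slope_sign(2)[OF K_sub K_flat] by blast

definition shift :: "int \<Rightarrow> (real \<Rightarrow> real) \<Rightarrow> real \<Rightarrow> real" where
  "shift i k = sp i \<circ> k \<circ> sp (- i)"

lemma shift_K: "k \<in> K \<Longrightarrow> shift i k \<in> K"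
  by (auto simp: shift_def K_def comp_mem sp_mem expo_comp expo_sp)

lemma shift_comp: "shift i (k \<circ> k') = shift i k \<circ> shift i k'"
  by (simp add: shift_def fun_eq_iff)

lemma shift_shift: "shift i (shift j k) = shift (i + j) k"
  by (simp add: shift_def fun_eq_iff algebra_simps)

text \<open>The first factor of \<open>g\<close> in the semidirect product of \<open>K\<close> and the powers of \<open>s\<close>.\<close>

definition kpart :: "(real \<Rightarrow> real) \<Rightarrow> real \<Rightarrow> real" where
  "kpart g = g \<circ> sp (- expo g)"

lemma kpart_K: "g \<in> G \<Longrightarrow> kpart g \<in> K"
  by (auto simp: kpart_def K_def comp_mem sp_mem expo_comp expo_sp)

lemma kpart_comp: "g \<in> G \<Longrightarrow> h \<in> G \<Longrightarrow> kpart (g \<circ> h) = kpart g \<circ> shift (expo g) (kpart h)"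
  by (simp add: kpart_def shift_def fun_eq_iff expo_comp algebra_simps)

definition base :: real where "base = (SOME p. p \<in> F)"

lemma base_F: "base \<in> F" unfolding base_def using F_ne by (rule some_in_eq[THEN iffD2])

text \<open>Restriction to a fundamental domain of \<open>s\<close>.\<close>

abbreviation tile :: "(real \<Rightarrow> real) \<Rightarrow> real \<Rightarrow> real" where
  "tile \<equiv> restrict_id (s base) base"

lemma tile_K: "k \<in> K \<Longrightarrow> k (s base) = s base" "k \<in> K \<Longrightarrow> k base = base"
  using K_fixes_F base_F F_inv[OF t_mem] by auto

lemma tile_comp: "k' \<in> K \<Longrightarrow> tile (k \<circ> k') = tile k \<circ> tile k'"
  using restrict_id_comp tile_K in_PLH K_sub by blast

lemma tile_PLH: "k \<in> K \<Longrightarrow> tile k \<in> carrier PLH"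
  using restrict_id_mem_PLH tile_K in_PLH K_sub t_decreases[OF base_F] by (metis order_less_imp_le)

text \<open>Elements of \<open>K\<close> are trivial near \<open>a\<close> and near \<open>b\<close>, and large powers of \<open>s\<close> move the fundamental domain there.\<close>

lemma shift_trivial_far:
  assumes k: "k \<in> K"
  obtains M :: nat where "\<And>i z. int M \<le> \<bar>i\<bar> \<Longrightarrow> s base \<le> z \<Longrightarrow> z \<le> base \<Longrightarrow> shift i k z = z"
proof -
  obtain u where u: "a < u" "\<And>y. a \<le> y \<Longrightarrow> y \<le> u \<Longrightarrow> k y = y"
    using germ_slope_one_right[OF K_flat[OF k] fixes_a[OF K_sub[OF k]]] by blast
  obtain v where v: "v < b" "\<And>y. v \<le> y \<Longrightarrow> y \<le> b \<Longrightarrow> k y = y"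
    using germ_slope_one_left[OF trivial_near_b[OF K_sub[OF k] K_flat[OF k]] fixes_b[OF K_sub[OF k]]] by blast
  obtain j where j: "sp (int j) base < u" using t_pow_to_a[OF base_F u(1)] by (auto simp: sp_int)
  obtain j' where j': "v < sp (- int j') base" using inv_t_pow_to_b[OF base_F v(1)] by (auto simp: sp_neg_int)
  show ?thesis
  proof (rule that[of "max j (Suc j')"])
    fix i z assume i: "int (max j (Suc j')) \<le> \<bar>i\<bar>" and z: "s base \<le> z" "z \<le> base"
    have zab: "a < z" "z < b" using z F_sub[OF base_F] F_sub[OF F_inv[OF t_mem base_F]] by auto
    have wab: "a < sp (- i) z" "sp (- i) z < b" using interval_iff[OF sp_mem] zab by auto
    have "k (sp (- i) z) = sp (- i) z"
    proof (cases "i \<le> 0")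
      case True
      have "sp (- i) z \<le> sp (- i) base" using z by simp
      also have "\<dots> \<le> sp (int j) base" using True i by (intro sp_antimono[OF base_F]) auto
      finally show ?thesis using u(2) wab j by simp
    next
      case False
      have "sp (- int j') base \<le> sp (1 - i) base" using False i by (intro sp_antimono[OF base_F]) auto
      also have "\<dots> = sp (- i) (s base)" using sp_sp[of "- i" 1 base] by (simp add: sp_1)
      also have "\<dots> \<le> sp (- i) z" using z by simp
      finally show ?thesis using v(2) wab j' by simp
    qed
    then show "shift i k z = z" by (simp add: shift_def)
  qed
qed

lemma tiles_cover:
  assumes "a < z" "z < b"
  obtains i where "s base \<le> sp i z" "sp i z \<le> base"
proof -
  obtain j where j: "z < sp (- int j) base" using inv_t_pow_to_b[OF base_F assms(2)] by (auto simp: sp_neg_int)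
  define q where "q = sp (- int j) base"
  have q: "q \<in> F" unfolding q_def by (rule F_inv[OF sp_mem base_F])
  define n where "n = (LEAST n. sp (int n) q < z)"
  have "\<exists>n. sp (int n) q < z" using t_pow_to_a[OF q assms(1)] by (simp add: sp_int)
  then have n: "sp (int n) q < z" unfolding n_def by (rule LeastI_ex)
  then have "n \<noteq> 0" using j by (intro notI) (simp add: q_def)
  then obtain n' where n': "n = Suc n'" using not0_implies_Suc by blast
  then have "z \<le> sp (int n') q"
    using not_less_Least[of n' "\<lambda>n. sp (int n) q < z"] unfolding n_def[symmetric] by simp
  then have "sp (int j - int n') z \<le> sp (int j - int n') (sp (int n') q)" unfolding sp_le_iff .
  then have 1: "sp (int j - int n') z \<le> base" by (simp add: q_def)
  have "sp (int j - int n') (sp (int n) q) < sp (int j - int n') z" using n unfolding sp_less_iff .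
  then have "sp 1 base < sp (int j - int n') z" by (simp add: q_def n')
  then show ?thesis using 1 that[of "int j - int n'"] by (simp add: sp_1)
qed

lemma subgroup_tile_K: "subgroup (tile ` K) PLH"
proof (rule subgroup_PLH_I)
  note KD = subgroup_PLH_D[OF subgroup_K]
  show "tile ` K \<subseteq> carrier PLH" using tile_PLH by blast
  have "tile id = id" by (simp add: restrict_id_def fun_eq_iff)
  then show "id \<in> tile ` K" using KD(2) by (metis imageI)
  show "f \<circ> g \<in> tile ` K" if "f \<in> tile ` K" "g \<in> tile ` K" for f g
    using that KD(3) tile_comp by (auto simp flip: tile_comp)
  show "finv f \<in> tile ` K" if f: "f \<in> tile ` K" for f
  proof -
    obtain k where k: "k \<in> K" "f = tile k" using f by blast
    have "tile (k \<circ> finv k) = tile k \<circ> tile (finv k)" using tile_comp KD(4)[OF k(1)] by blast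
    moreover have "k \<circ> finv k = id" using PLH_f_inv[OF KD(1)[OF k(1)]] by (simp add: fun_eq_iff)
    ultimately have "tile k \<circ> tile (finv k) = id" using \<open>tile id = id\<close> by simp
    then have "finv f = tile (finv k)" using tile_PLH[OF k(1)] k(2)
      by (metis PLH_inv_f comp_apply ext id_apply)
    then show ?thesis using KD(4)[OF k(1)] by blast
  qed
qed

lemma derived_le_K: "derived PLH G \<subseteq> K"
  unfolding derived_def
proof (rule PLH.generate_subgroup_incl[OF _ subgroup_K])
  show "derived_set PLH G \<subseteq> K"
    using inv_PLH in_PLH comp_mem finv_mem by (auto simp: K_def expo_comp expo_finv)
qed

text \<open>If \<open>i\<close> is so large that \<open>s\<^sup>i k\<inverse> s\<^sup>-\<^sup>i\<close> is trivial on the fundamental domain, the commutator of \<open>k\<close> and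
\<open>s\<^sup>i\<close> agrees there with \<open>k\<close>.\<close>

lemma tile_K_eq_tile_derived: "tile ` K \<subseteq> tile ` derived PLH G"
proof
  fix f assume "f \<in> tile ` K"
  then obtain k where k: "k \<in> K" "f = tile k" by blast
  have ik: "finv k \<in> K" using subgroup_PLH_D(4)[OF subgroup_K k(1)] .
  obtain M :: nat where M: "\<And>i z. int M \<le> \<bar>i\<bar> \<Longrightarrow> s base \<le> z \<Longrightarrow> z \<le> base \<Longrightarrow> shift i (finv k) z = z"
    using shift_trivial_far[OF ik] by blast
  let ?u = "k \<circ> sp (int M) \<circ> finv k \<circ> finv (sp (int M))"
  have "?u \<in> derived PLH G"
    by (rule commutator_mem_derived) (use K_sub[OF k(1)] sp_mem in_PLH in auto)
  moreover have "?u = k \<circ> shift (int M) (finv k)" by (simp add: shift_def finv_sp comp_assoc)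
  then have "tile ?u = tile k" using M[of "int M"] by (auto simp: restrict_id_def fun_eq_iff)
  ultimately show "f \<in> tile ` derived PLH G" using k(2) by (metis imageI)
qed

text \<open>One step of the derived series is gained because \<open>K\<close> and \<open>G'\<close> have the same restriction.\<close>

lemma derived_tile_K:
  assumes "(derived PLH ^^ Suc n) G \<subseteq> {id}"
  shows "(derived PLH ^^ n) (tile ` K) \<subseteq> {id}"
proof -
  let ?P = "PLH\<lparr>carrier := K\<rparr>"
  have gK: "group ?P" using PLH.subgroup_imp_group[OF subgroup_K] .
  have "tile \<in> hom ?P PLH"
    by (rule homI) (auto simp: tile_PLH tile_comp)
  then interpret r: group_hom ?P PLH tile
    using gK by (simp add: group_hom_def group_hom_axioms_def group_PLH)
  have cons: "(derived ?P ^^ i) (derived PLH G) = (derived PLH ^^ i) (derived PLH G) \<and>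
      (derived PLH ^^ i) (derived PLH G) \<subseteq> K" for i
  proof (induction i)
    case (Suc i)
    then show ?case
      using PLH.derived_consistent[OF _ subgroup_K] PLH.derived_incl[OF _ subgroup_K] by simp
  qed (simp add: derived_le_K)
  have "(derived PLH ^^ n) (tile ` K) \<subseteq> (derived PLH ^^ n) (tile ` derived PLH G)"
    by (rule PLH.mono_exp_of_derived[OF tile_K_eq_tile_derived])
  also have "\<dots> = tile ` ((derived ?P ^^ n) (derived PLH G))"
    using r.exp_of_derived_img[of "derived PLH G" n] derived_le_K by simp
  also have "\<dots> = tile ` ((derived PLH ^^ Suc n) G)" using cons[of n] by (simp add: funpow_swap1)
  also have "\<dots> \<subseteq> {id}" using assms by (auto simp: restrict_id_def fun_eq_iff)
  finally show ?thesis .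
qed

text \<open>The coordinate at \<open>i\<close> of the image of \<open>g\<close> records, after conjugation by \<open>s\<^sup>i\<close>, what the \<open>K\<close>-part of \<open>g\<close>
does on the tile \<open>s\<^sup>-\<^sup>i [s p, p]\<close>. Multiplying by \<open>s\<^sup>m\<close> from the left shifts the coordinates by \<open>m\<close>, in
accordance with the action in \<^const>\<open>wreath_product\<close>.\<close>

lemma wreath_hom:
  assumes T: "group T" and h: "h \<in> hom (PLH\<lparr>carrier := tile ` K\<rparr>) T" "inj_on h (tile ` K)"
  obtains \<Theta> where "\<Theta> \<in> hom (PLH\<lparr>carrier := G\<rparr>) (wreath_product T integer_group)"
    "\<And>g. g \<in> G \<Longrightarrow> \<Theta> g = \<one>\<^bsub>wreath_product T integer_group\<^esub> \<longleftrightarrow> (\<forall>x. a \<le> x \<and> x \<le> b \<longrightarrow> g x = x)"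
proof -
  let ?P = "PLH\<lparr>carrier := tile ` K\<rparr>"
  have gP: "group ?P" using PLH.subgroup_imp_group[OF subgroup_tile_K] .
  interpret h: group_hom ?P T h using gP T h(1) by (simp add: group_hom_def group_hom_axioms_def)
  have h_id: "h id = \<one>\<^bsub>T\<^esub>" using h.hom_one by simp
  have id_tile: "id \<in> tile ` K" using subgroup_PLH_D(2)[OF subgroup_tile_K] .
  have h_one: "h f = \<one>\<^bsub>T\<^esub> \<longleftrightarrow> f = id" if "f \<in> tile ` K" for f
    using inj_onD[OF h(2), of f id] that id_tile h_id by auto
  define \<Theta> where "\<Theta> g = ((\<lambda>i. h (tile (shift i (kpart g)))), expo g)" for g
  let ?W = "wreath_product T integer_group"
  have mult_W: "(c, i) \<otimes>\<^bsub>?W\<^esub> (d, j) = ((\<lambda>x. c x \<otimes>\<^bsub>T\<^esub> d (x + i)), i + j)" for c d i j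
    by (simp add: wreath_product_def Let_def fun_eq_iff)
  have one_W: "\<one>\<^bsub>?W\<^esub> = ((\<lambda>x. \<one>\<^bsub>T\<^esub>), 0)"
    by (simp add: wreath_product_def Let_def fun_eq_iff)
  have carrier_W: "(c, i) \<in> carrier ?W \<longleftrightarrow> (\<forall>x. c x \<in> carrier T) \<and> finite {x. c x \<noteq> \<one>\<^bsub>T\<^esub>}" for c i
    using T by (simp add: wreath_product_def Let_def carrier_sum_group) auto
  have mem: "tile (shift i (kpart g)) \<in> tile ` K" if "g \<in> G" for g i
    using shift_K[OF kpart_K[OF that]] by blast
  have "\<Theta> \<in> hom (PLH\<lparr>carrier := G\<rparr>) ?W"
  proof (rule homI)
    fix g assume "g \<in> carrier (PLH\<lparr>carrier := G\<rparr>)"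
    then have g: "g \<in> G" by simp
    obtain M :: nat where M: "\<And>i z. int M \<le> \<bar>i\<bar> \<Longrightarrow> s base \<le> z \<Longrightarrow> z \<le> base \<Longrightarrow> shift i (kpart g) z = z"
      using shift_trivial_far[OF kpart_K[OF g]] by blast
    have "{i. h (tile (shift i (kpart g))) \<noteq> \<one>\<^bsub>T\<^esub>} \<subseteq> {- int M..int M}"
    proof
      fix i assume "i \<in> {i. h (tile (shift i (kpart g))) \<noteq> \<one>\<^bsub>T\<^esub>}"
      then have "tile (shift i (kpart g)) \<noteq> id" using h_id by auto
      then have "\<not> int M \<le> \<bar>i\<bar>" using M by (auto simp: restrict_id_eq_id_iff)
      then show "i \<in> {- int M..int M}" by auto
    qed
    then have "finite {i. h (tile (shift i (kpart g))) \<noteq> \<one>\<^bsub>T\<^esub>}" by (rule finite_subset) simp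
    then show "\<Theta> g \<in> carrier ?W"
      using mem[OF g] h.hom_closed by (simp add: \<Theta>_def carrier_W)
  next
    fix g g' assume "g \<in> carrier (PLH\<lparr>carrier := G\<rparr>)" "g' \<in> carrier (PLH\<lparr>carrier := G\<rparr>)"
    then have g: "g \<in> G" "g' \<in> G" by simp_all
    have "tile (shift i (kpart (g \<circ> g'))) = tile (shift i (kpart g)) \<circ> tile (shift (i + expo g) (kpart g'))" for i
      by (simp add: kpart_comp g shift_comp shift_shift tile_comp shift_K kpart_K)
    moreover have "h (tile (shift i (kpart g)) \<circ> tile (shift j (kpart g'))) =
        h (tile (shift i (kpart g))) \<otimes>\<^bsub>T\<^esub> h (tile (shift j (kpart g')))" for i j
      using h.hom_mult[of "tile (shift i (kpart g))" "tile (shift j (kpart g'))"] mem g by simp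
    ultimately show "\<Theta> (g \<otimes>\<^bsub>PLH\<lparr>carrier := G\<rparr>\<^esub> g') = \<Theta> g \<otimes>\<^bsub>?W\<^esub> \<Theta> g'"
      using g by (simp add: \<Theta>_def mult_W expo_comp)
  qed
  moreover have "\<Theta> g = \<one>\<^bsub>?W\<^esub> \<longleftrightarrow> (\<forall>x. a \<le> x \<and> x \<le> b \<longrightarrow> g x = x)" if g: "g \<in> G" for g
  proof
    assume "\<Theta> g = \<one>\<^bsub>?W\<^esub>"
    then have *: "expo g = 0" "\<And>i. h (tile (shift i (kpart g))) = \<one>\<^bsub>T\<^esub>"
      by (auto simp: \<Theta>_def one_W fun_eq_iff)
    have "kpart g = g" using *(1) by (simp add: kpart_def fun_eq_iff)
    then have id: "tile (shift i g) = id" for i using *(2)[of i] h_one mem[OF g, of i] by simp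
    show "\<forall>x. a \<le> x \<and> x \<le> b \<longrightarrow> g x = x"
    proof (intro allI impI)
      fix x assume x: "a \<le> x \<and> x \<le> b"
      show "g x = x"
      proof (cases "x = a \<or> x = b")
        case True then show ?thesis using fixes_a fixes_b g by auto
      next
        case False
        then obtain i where "s base \<le> sp i x" "sp i x \<le> base" using x tiles_cover[of x] by auto
        then have "shift i g (sp i x) = sp i x" using id[of i] by (simp add: restrict_id_eq_id_iff)
        then have "sp i (g x) = sp i x" by (simp add: shift_def)
        then have "sp (- i) (sp i (g x)) = sp (- i) (sp i x)" by simp
        then show ?thesis by simp
      qed
    qed
  next
    assume triv: "\<forall>x. a \<le> x \<and> x \<le> b \<longrightarrow> g x = x"
    have "germ_slope g a 1 1"
      by (rule germ_slope_cong[OF germ_slope_id, of "b - a"]) (use triv ab in auto)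
    then have e: "expo g = 0" using expo_eq_iff[OF g, of 0] by simp
    then have k: "kpart g = g" by (simp add: kpart_def fun_eq_iff)
    have "tile (shift i g) = id" for i
      unfolding restrict_id_eq_id_iff
    proof (intro allI impI)
      fix x assume "s base \<le> x \<and> x \<le> base"
      then have "a < x" "x < b" using F_sub[OF base_F] F_sub[OF F_inv[OF t_mem base_F]] by auto
      then have "a < sp (- i) x" "sp (- i) x < b" using interval_iff[OF sp_mem] by auto
      then show "shift i g x = x" using triv by (simp add: shift_def)
    qed
    then show "\<Theta> g = \<one>\<^bsub>?W\<^esub>" by (simp add: \<Theta>_def one_W e k h_id)
  qed
  ultimately show ?thesis by (rule that)
qed

end

lemma (in orbital) orbital_wreath_hom:
  assumes n: "(derived PLH ^^ Suc n) G \<subseteq> {id}" and T: "group T"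
    and embed: "\<And>H. subgroup H PLH \<Longrightarrow> (derived PLH ^^ n) H \<subseteq> {id} \<Longrightarrow>
      \<exists>h. h \<in> hom (PLH\<lparr>carrier := H\<rparr>) T \<and> inj_on h H"
  shows "\<exists>\<Theta>. \<Theta> \<in> hom (PLH\<lparr>carrier := G\<rparr>) (wreath_product T integer_group) \<and>
    (\<forall>g\<in>G. \<Theta> g = \<one>\<^bsub>wreath_product T integer_group\<^esub> \<longleftrightarrow> (\<forall>x. a \<le> x \<and> x \<le> b \<longrightarrow> g x = x))"
proof -
  obtain F t \<tau> where "closed_central_orbital G a b F t \<tau>" using ex_closed_central_orbital[OF n] .
  then interpret c: closed_central_orbital G a b F t \<tau> .
  obtain s l where s: "s \<in> G" "germ_slope s a 1 l" "l < 1"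
    "\<And>g m. g \<in> G \<Longrightarrow> germ_slope g a 1 m \<Longrightarrow> \<exists>k::int. m = l powi k"
    using c.slope_generator by blast
  interpret y: cyclic_orbital G a b F s l
    by unfold_locales (use s c.F_sub c.F_ne c.F_inv c.commutator_fixes_F in auto)
  obtain h where h: "h \<in> hom (PLH\<lparr>carrier := y.tile ` y.K\<rparr>) T" "inj_on h (y.tile ` y.K)"
    using embed[OF y.subgroup_tile_K y.derived_tile_K[OF n]] by blast
  show ?thesis using y.wreath_hom[OF T h] by metis
qed

section \<open>Assembling the orbitals\<close>

lemma infinite_real_three:
  assumes "infinite (S :: real set)"
  obtains x y z where "x \<in> S" "y \<in> S" "z \<in> S" "x < y" "y < z"
proof -
  obtain R where R: "R \<subseteq> S" "finite R" "card R = 3"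
    using infinite_arbitrarily_large[OF assms, of 3] by blast
  then have ne: "R \<noteq> {}" by auto
  have "card (R - {Min R, Max R}) \<noteq> 0"
    using card_Diff_subset[of "{Min R, Max R}" R] R ne card_insert_le_m1[of 2 "{Max R}" "Min R"] by auto
  then obtain y where y: "y \<in> R" "y \<noteq> Min R" "y \<noteq> Max R" by (metis DiffE card.empty ex_in_conv insertCI)
  then have "Min R < y" "y < Max R" using R(2) by (auto simp: order_less_le)
  then show ?thesis using that[of "Min R" y "Max R"] y(1) R(1) Min_in[OF R(2) ne] Max_in[OF R(2) ne] by blast
qed

text \<open>At an accumulation point of \<open>X\<close> the map is affine on either side. An affine map with two fixed points
is the identity, so \<open>X\<close> has at most two points on either side close by.\<close>

lemma finite_if_separated_by_fixed_points:
  assumes g: "g \<in> carrier PLH" and moved: "\<And>x. x \<in> X \<Longrightarrow> g x \<noteq> x"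
    and sep: "\<And>x y. x \<in> X \<Longrightarrow> y \<in> X \<Longrightarrow> x < y \<Longrightarrow> \<exists>z. x < z \<and> z < y \<and> g z = z"
  shows "finite X"
proof (rule ccontr)
  assume "infinite X"
  have affine: "finite (X \<inter> {u..v})" if aff: "\<And>x. u \<le> x \<Longrightarrow> x \<le> v \<Longrightarrow> g x = \<alpha> + \<beta> * x" for u v \<alpha> \<beta>
  proof (rule ccontr)
    assume "infinite (X \<inter> {u..v})"
    then obtain x y z where X: "x \<in> X \<inter> {u..v}" "y \<in> X \<inter> {u..v}" "z \<in> X \<inter> {u..v}" "x < y" "y < z"
      by (rule infinite_real_three)
    obtain p where p: "x < p" "p < y" "g p = p" using sep X by blast
    obtain q where q: "y < q" "q < z" "g q = q" using sep X by blast
    have "p = \<alpha> + \<beta> * p" "q = \<alpha> + \<beta> * q" using aff[of p] aff[of q] p q X by auto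
    then have "(1 - \<beta>) * (q - p) = 0" by (simp add: algebra_simps)
    then have "\<beta> = 1" using p q by simp
    then have "\<alpha> = 0" using \<open>p = \<alpha> + \<beta> * p\<close> by simp
    then have "g x = x" using aff[of x] \<open>\<beta> = 1\<close> X by simp
    then show False using moved X by blast
  qed
  have "X \<subseteq> {0..1}" using moved PLH_fix_outside[OF g] by blast
  then obtain c where c: "c islimpt X"
    using \<open>infinite X\<close> compact_Icc[of "0::real" 1] unfolding compact_eq_Bolzano_Weierstrass by blast
  obtain m where m: "germ_slope g c 1 m" using PLH_germ[OF g] by metis
  obtain n where n: "germ_slope g c (-1) n" using PLH_germ[OF g] by metis
  obtain e where e: "0 < e" "\<And>y. 0 \<le> y \<Longrightarrow> y \<le> e \<Longrightarrow> g (c + 1 * y) = g c + m * 1 * y"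
    using germ_slopeE[OF m, of 1] by auto
  obtain e' where e': "0 < e'" "e' \<le> e" "\<And>y. 0 \<le> y \<Longrightarrow> y \<le> e' \<Longrightarrow> g (c + -1 * y) = g c + n * -1 * y"
    using germ_slopeE[OF n e(1)] by auto
  have "finite (X \<inter> {c..c + e})"
  proof (rule affine[of _ _ "g c - m * c" m])
    fix x assume "c \<le> x" "x \<le> c + e"
    then show "g x = g c - m * c + m * x" using e(2)[of "x - c"] by (simp add: algebra_simps)
  qed
  moreover have "finite (X \<inter> {c - e'..c})"
  proof (rule affine[of _ _ "g c - n * c" n])
    fix x assume "c - e' \<le> x" "x \<le> c"
    then show "g x = g c - n * c + n * x" using e'(3)[of "c - x"] by (simp add: algebra_simps)
  qed
  ultimately have "finite (X \<inter> {c..c + e} \<union> X \<inter> {c - e'..c})" by simp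
  moreover have "X \<inter> ball c e' \<subseteq> X \<inter> {c..c + e} \<union> X \<inter> {c - e'..c}"
    using e'(2) by (auto simp: dist_real_def)
  ultimately have "finite (X \<inter> ball c e')" by (rule rev_finite_subset)
  then show False using c e'(1) islimpt_eq_infinite_ball by blast
qed

lemma ex_orbital_around:
  assumes G: "subgroup G PLH" and x: "\<exists>g\<in>G. g x \<noteq> x"
  obtains a b where "orbital G a b" "a < x" "x < b"
proof -
  note G' = subgroup_PLH_D[OF G]
  define fixed where "fixed y \<longleftrightarrow> (\<forall>g\<in>G. g y = y)" for y
  have "x \<in> {0..1}" using x PLH_fix_outside[OF G'(1)] by blast
  then have x01: "0 \<le> x" "x \<le> 1" by simp_all
  have "fixed y" if "y \<notin> {0..1}" for y using PLH_fix_outside[OF G'(1) that] by (simp add: fixed_def)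
  then have out: "fixed (-1)" "fixed 2" by simp_all
  have closed: "fixed y" if "\<And>\<epsilon>. \<epsilon> > 0 \<Longrightarrow> \<exists>q. fixed q \<and> \<bar>q - y\<bar> < \<epsilon>" for y
    unfolding fixed_def
  proof
    fix g assume g: "g \<in> G"
    show "g y = y"
    proof (rule fixed_points_closed[OF G'(1)[OF g]])
      fix \<epsilon> :: real assume "\<epsilon> > 0"
      then show "\<exists>q. g q = q \<and> \<bar>q - y\<bar> < \<epsilon>" using that g unfolding fixed_def by blast
    qed
  qed
  define L where "L = {y. y < x \<and> fixed y}"
  define R where "R = {y. x < y \<and> fixed y}"
  have L: "L \<noteq> {}" "bdd_above L" using out x01 by (auto simp: L_def intro!: bdd_aboveI[of _ x] exI[of _ "-1"])
  have R: "R \<noteq> {}" "bdd_below R" using out x01 by (auto simp: R_def intro!: bdd_belowI[of _ x] exI[of _ "2"])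
  define a where "a = Sup L"
  define b where "b = Inf R"
  have La: "y \<le> a" if "y \<in> L" for y unfolding a_def using that L by (intro cSup_upper)
  have Rb: "b \<le> y" if "y \<in> R" for y unfolding b_def using that R by (intro cInf_lower)
  have "fixed a"
  proof (rule closed)
    fix \<epsilon> :: real assume "\<epsilon> > 0"
    then obtain q where "q \<in> L" "a - \<epsilon> < q" using less_cSup_iff[OF L, of "a - \<epsilon>"] unfolding a_def by auto
    then show "\<exists>q. fixed q \<and> \<bar>q - a\<bar> < \<epsilon>" using La[of q] by (intro exI[of _ q]) (auto simp: L_def)
  qed
  have "fixed b"
  proof (rule closed)
    fix \<epsilon> :: real assume "\<epsilon> > 0"
    then obtain q where "q \<in> R" "q < b + \<epsilon>" using cInf_less_iff[OF R, of "b + \<epsilon>"] unfolding b_def by auto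
    then show "\<exists>q. fixed q \<and> \<bar>q - b\<bar> < \<epsilon>" using Rb[of q] by (intro exI[of _ q]) (auto simp: R_def)
  qed
  have "\<not> fixed x" using x by (auto simp: fixed_def)
  moreover have "a \<le> x" unfolding a_def using L by (intro cSup_least) (auto simp: L_def)
  moreover have "x \<le> b" unfolding b_def using R by (intro cInf_greatest) (auto simp: R_def)
  ultimately have axb: "a < x" "x < b" using \<open>fixed a\<close> \<open>fixed b\<close> by (auto simp: order_less_le)
  have "orbital G a b"
  proof (rule orbital.intro[OF G])
    show "\<exists>g\<in>G. g y \<noteq> y" if "a < y" "y < b" for y
    proof (rule ccontr)
      assume "\<not> ?thesis"
      then have "fixed y" by (auto simp: fixed_def)
      then show False using La[of y] Rb[of y] that \<open>\<not> fixed x\<close>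
        by (cases y x rule: linorder_cases) (auto simp: L_def R_def)
    qed
  qed (use axb \<open>fixed a\<close> \<open>fixed b\<close> in \<open>auto simp: fixed_def\<close>)
  then show ?thesis using that axb by blast
qed

lemma orbitals_disjoint:
  assumes "orbital G a b" "orbital G a' b'" "a < x" "x < b" "a' < x" "x < b'"
  shows "a = a' \<and> b = b'"
proof -
  have *: "c \<le> a \<or> b \<le> c" if "orbital G a b" "\<And>g. g \<in> G \<Longrightarrow> g c = c" for a b c
    using orbital.moves[OF that(1), of c] that(2) by force
  have "a' \<le> a \<or> b \<le> a'" "b' \<le> a \<or> b \<le> b'" "a \<le> a' \<or> b' \<le> a" "b \<le> a' \<or> b' \<le> b"
    using * assms(1,2) orbital.fixes_a orbital.fixes_b by metis+
  then show ?thesis using assms(3-) by linarith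
qed

text \<open>The orbitals are indexed by integers by choosing a rational number in each. The coordinate at the index
of an orbital is the homomorphism into the wreath product that belongs to it; all other coordinates
are trivial.\<close>

lemma solvable_subgroup_of_PLH_embeds:
  assumes "subgroup G PLH" "(derived PLH ^^ n) G \<subseteq> {id}"
  shows "\<exists>h. h \<in> hom (PLH\<lparr>carrier := G\<rparr>) (G_tower n) \<and> inj_on h G"
  using assms
proof (induction n arbitrary: G)
  case 0
  then show ?case by (intro exI[of _ "\<lambda>_. Trivial"]) (auto simp: hom_def inj_on_def)
next
  case (Suc n)
  note G = Suc.prems(1) and G' = subgroup_PLH_D[OF Suc.prems(1)]
  let ?W = "wreath_product (G_tower n) integer_group"
  let ?G = "PLH\<lparr>carrier := G\<rparr>"
  have W: "group ?W" by (simp add: group_wreath_product group_G_tower)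
  interpret W: group ?W by (rule W)
  define Orb where "Orb = {(a, b). orbital G a b}"
  have "\<forall>A\<in>Orb. \<exists>\<Theta>. \<Theta> \<in> hom ?G ?W \<and>
      (\<forall>g\<in>G. \<Theta> g = \<one>\<^bsub>?W\<^esub> \<longleftrightarrow> (\<forall>x. fst A \<le> x \<and> x \<le> snd A \<longrightarrow> g x = x))"
  proof
    fix A assume "A \<in> Orb"
    then have "orbital G (fst A) (snd A)" by (auto simp: Orb_def)
    from orbital.orbital_wreath_hom[OF this Suc.prems(2) group_G_tower Suc.IH]
    show "\<exists>\<Theta>. \<Theta> \<in> hom ?G ?W \<and>
        (\<forall>g\<in>G. \<Theta> g = \<one>\<^bsub>?W\<^esub> \<longleftrightarrow> (\<forall>x. fst A \<le> x \<and> x \<le> snd A \<longrightarrow> g x = x))" by blast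
  qed
  then obtain \<Theta> where \<Theta>_hom: "\<And>A. A \<in> Orb \<Longrightarrow> \<Theta> A \<in> hom ?G ?W"
    and \<Theta>_one: "\<And>A g. A \<in> Orb \<Longrightarrow> g \<in> G \<Longrightarrow> \<Theta> A g = \<one>\<^bsub>?W\<^esub> \<longleftrightarrow> (\<forall>x. fst A \<le> x \<and> x \<le> snd A \<longrightarrow> g x = x)"
    by metis
  have "\<forall>A\<in>Orb. \<exists>r::rat. fst A < of_rat r \<and> of_rat r < snd A"
    using orbital.ab of_rat_dense by (fastforce simp: Orb_def)
  then obtain r :: "real \<times> real \<Rightarrow> rat" where r: "\<And>A. A \<in> Orb \<Longrightarrow> fst A < of_rat (r A) \<and> of_rat (r A) < snd A"
    by metis
  have "inj_on r Orb"
  proof (rule inj_onI)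
    fix A B assume "A \<in> Orb" "B \<in> Orb" "r A = r B"
    then show "A = B" using r[of A] r[of B] orbitals_disjoint[of G "fst A" "snd A" "fst B" "snd B" "of_rat (r A)"]
      by (auto simp: Orb_def)
  qed
  define idx where "idx A = int (to_nat (r A))" for A
  have idx: "inj_on idx Orb" using \<open>inj_on r Orb\<close> by (auto simp: inj_on_def idx_def)
  define \<Phi> where "\<Phi> g = (\<lambda>k. if k \<in> idx ` Orb then \<Theta> (inv_into Orb idx k) g else \<one>\<^bsub>?W\<^esub>)" for g
  have \<Phi>_idx: "\<Phi> g (idx A) = \<Theta> A g" if "A \<in> Orb" for g A
    using that idx by (simp add: \<Phi>_def)
  have fin: "finite {A \<in> Orb. \<Theta> A g \<noteq> \<one>\<^bsub>?W\<^esub>}" if g: "g \<in> G" for g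
  proof -
    let ?B = "{A \<in> Orb. \<Theta> A g \<noteq> \<one>\<^bsub>?W\<^esub>}"
    have "\<forall>A\<in>?B. \<exists>x. fst A < x \<and> x < snd A \<and> g x \<noteq> x"
    proof
      fix A assume A: "A \<in> ?B"
      then obtain x where x: "fst A \<le> x" "x \<le> snd A" "g x \<noteq> x" using \<Theta>_one g by blast
      have o: "orbital G (fst A) (snd A)" using A by (auto simp: Orb_def)
      have "x \<noteq> fst A" "x \<noteq> snd A" using orbital.fixes_a[OF o g] orbital.fixes_b[OF o g] x by auto
      then show "\<exists>x. fst A < x \<and> x < snd A \<and> g x \<noteq> x" using x by (intro exI[of _ x]) auto
    qed
    from bchoice[OF this] obtain \<xi> where "\<forall>A\<in>?B. fst A < \<xi> A \<and> \<xi> A < snd A \<and> g (\<xi> A) \<noteq> \<xi> A" ..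
    then have \<xi>: "fst A < \<xi> A \<and> \<xi> A < snd A \<and> g (\<xi> A) \<noteq> \<xi> A" if "A \<in> ?B" for A using that by (rule bspec)
    have o: "orbital G (fst A) (snd A)" if "A \<in> ?B" for A using that by (auto simp: Orb_def)
    have "finite (\<xi> ` ?B)"
    proof (rule finite_if_separated_by_fixed_points[OF G'(1)[OF g]])
      show "g x \<noteq> x" if "x \<in> \<xi> ` ?B" for x using that \<xi> by blast
      show "\<exists>z. x < z \<and> z < y \<and> g z = z" if xy: "x \<in> \<xi> ` ?B" "y \<in> \<xi> ` ?B" "x < y" for x y
      proof -
        obtain A where A: "A \<in> ?B" "x = \<xi> A" using xy(1) by blast
        obtain B where B: "B \<in> ?B" "y = \<xi> B" using xy(2) by blast
        have "\<not> y < snd A"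
        proof
          assume "y < snd A"
          then have "fst A = fst B \<and> snd A = snd B"
            using orbitals_disjoint[OF o[OF A(1)] o[OF B(1)], of y] \<xi>[OF A(1)] \<xi>[OF B(1)] A(2) B(2) xy(3) by simp
          then show False using A(2) B(2) xy(3) by (simp add: prod_eq_iff[symmetric])
        qed
        moreover have "g (snd A) = snd A" using orbital.fixes_b[OF o[OF A(1)] g] .
        moreover have "y \<noteq> snd A" using calculation(2) \<xi>[OF B(1)] B(2) by auto
        ultimately show ?thesis using \<xi>[OF A(1)] A(2) by (intro exI[of _ "snd A"]) auto
      qed
    qed
    moreover have "inj_on \<xi> ?B"
    proof (rule inj_onI)
      fix A B assume AB: "A \<in> ?B" "B \<in> ?B" "\<xi> A = \<xi> B"
      then have "fst A = fst B \<and> snd A = snd B"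
        using orbitals_disjoint[OF o[OF AB(1)] o[OF AB(2)], of "\<xi> A"] \<xi>[OF AB(1)] \<xi>[OF AB(2)] by simp
      then show "A = B" by (simp add: prod_eq_iff)
    qed
    ultimately show ?thesis by (rule finite_imageD)
  qed
  let ?S = "sum_group UNIV (\<lambda>k::int. ?W)"
  have S: "group ?S" using W by simp
  have "\<Phi> \<in> hom ?G ?S"
  proof (rule homI)
    fix g assume "g \<in> carrier ?G"
    then have g: "g \<in> G" by simp
    have "\<Phi> g k \<in> carrier ?W" for k
      using hom_in_carrier[OF \<Theta>_hom[OF inv_into_into[of k idx Orb]], of g] g W.one_closed
      by (simp add: \<Phi>_def)
    moreover have "{k. \<Phi> g k \<noteq> \<one>\<^bsub>?W\<^esub>} \<subseteq> idx ` {A \<in> Orb. \<Theta> A g \<noteq> \<one>\<^bsub>?W\<^esub>}"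
    proof
      fix k assume k: "k \<in> {k. \<Phi> g k \<noteq> \<one>\<^bsub>?W\<^esub>}"
      then obtain A where "A \<in> Orb" "k = idx A" by (auto simp: \<Phi>_def split: if_splits)
      then show "k \<in> idx ` {A \<in> Orb. \<Theta> A g \<noteq> \<one>\<^bsub>?W\<^esub>}" using k \<Phi>_idx by auto
    qed
    then have "finite {k. \<Phi> g k \<noteq> \<one>\<^bsub>?W\<^esub>}" using fin[OF g] by (meson finite_imageI finite_subset)
    ultimately show "\<Phi> g \<in> carrier ?S" using W by (simp add: carrier_sum_group PiE_iff)
  next
    fix g g' assume "g \<in> carrier ?G" "g' \<in> carrier ?G"
    then have "\<Phi> (g \<otimes>\<^bsub>?G\<^esub> g') k = \<Phi> g k \<otimes>\<^bsub>?W\<^esub> \<Phi> g' k" for k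
      using hom_mult[OF \<Theta>_hom[OF inv_into_into[of k idx Orb]], of g g'] by (simp add: \<Phi>_def)
    then show "\<Phi> (g \<otimes>\<^bsub>?G\<^esub> g') = \<Phi> g \<otimes>\<^bsub>?S\<^esub> \<Phi> g'" by (simp add: fun_eq_iff)
  qed
  moreover have "Node \<in> hom ?S (G_tower (Suc n))"
    using iso_Node[OF S] by (simp add: iso_def)
  ultimately have hom: "Node \<circ> \<Phi> \<in> hom ?G (G_tower (Suc n))" by (rule hom_compose)
  have trivial: "g = id" if g: "g \<in> G" "\<Phi> g = (\<lambda>k. \<one>\<^bsub>?W\<^esub>)" for g
  proof
    fix x show "g x = id x"
    proof (cases "\<exists>f\<in>G. f x \<noteq> x")
      case True
      then obtain a b where ab: "orbital G a b" "a < x" "x < b" using ex_orbital_around[OF G] by blast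
      then have o: "(a, b) \<in> Orb" by (simp add: Orb_def)
      then have "\<Theta> (a, b) g = \<one>\<^bsub>?W\<^esub>" using \<Phi>_idx[OF o, of g] g(2) by simp
      then show ?thesis using \<Theta>_one[OF o g(1)] ab(2,3) by auto
    qed (use g in auto)
  qed
  have "inj_on (Node \<circ> \<Phi>) (carrier ?G)"
  proof -
    interpret h: group_hom ?G "G_tower (Suc n)" "Node \<circ> \<Phi>"
      using hom PLH.subgroup_imp_group[OF G] group_G_tower
      by (simp add: group_hom_def group_hom_axioms_def del: G_tower.simps)
    have one: "\<one>\<^bsub>G_tower (Suc n)\<^esub> = Node (\<lambda>k. \<one>\<^bsub>?W\<^esub>)"
      by (simp add: image_group_def fun_eq_iff)
    have "kernel ?G (G_tower (Suc n)) (Node \<circ> \<Phi>) \<subseteq> {\<one>\<^bsub>?G\<^esub>}"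
      using trivial unfolding kernel_def one by auto
    moreover have "\<one>\<^bsub>?G\<^esub> \<in> kernel ?G (G_tower (Suc n)) (Node \<circ> \<Phi>)"
      using h.hom_one G'(2) by (simp add: kernel_def del: G_tower.simps)
    ultimately show ?thesis using h.inj_iff_trivial_ker by blast
  qed
  then have "inj_on (Node \<circ> \<Phi>) G" by simp
  with hom show ?case by blast
qed

section \<open>From the interval to the line\<close>

lemma PL_o_D:
  assumes "f \<in> carrier PL_o"
  shows "f \<in> Bij {0..1}" "f \<in> extensional {0..1}" "strict_mono_on {0..1} f" "piecewise_linear_on_I f"
    "f ` {0..1} = {0..1}" "f 0 = 0" "f 1 = 1"
proof -
  show "f \<in> Bij {0..1}" using subgroup.subset[OF subgroup_PL_o] assms by (auto simp: BijGroup_def)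
  show ext: "f \<in> extensional {0..1}" and m: "strict_mono_on {0..1} f" and "piecewise_linear_on_I f"
    using assms by (auto simp: PL_o_def)
  show im: "f ` {0..1} = {0..1}" using assms by (auto simp: PL_o_def homeomorphism_def)
  have mono: "f x \<le> f y" if "0 \<le> x" "x \<le> y" "y \<le> 1" for x y
    using strict_mono_onD[OF m, of x y] that by (cases "x = y") auto
  have le: "0 \<le> f x" "f x \<le> 1" if "0 \<le> x" "x \<le> 1" for x
    using im that by (metis atLeastAtMost_iff imageI)+
  obtain x where "x \<in> {0..1}" "f x = 0" using im by (metis (full_types) atLeastAtMost_iff imageE le_numeral_extra(1,3) zero_le_one)
  then show "f 0 = 0" using mono[of 0 x] le[of 0] by auto
  obtain x where "x \<in> {0..1}" "f x = 1" using im by (metis (full_types) atLeastAtMost_iff imageE le_numeral_extra(4) zero_le_one)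
  then show "f 1 = 1" using mono[of x 1] le[of 1] by auto
qed

text \<open>The finitely many breaks leave an affine piece on each side of every point.\<close>

lemma extend_PL_o_mem_PLH:
  assumes f: "f \<in> carrier PL_o"
  shows "restrict_id 0 1 f \<in> carrier PLH"
proof -
  note F = PL_o_D[OF f]
  let ?r = "restrict_id 0 1 f"
  have le: "0 \<le> f x" "f x \<le> 1" if "0 \<le> x" "x \<le> 1" for x
    using F(5) that by (metis atLeastAtMost_iff imageI)+
  have less: "f x < f y" if "0 \<le> x" "x < y" "y \<le> 1" for x y
    using strict_mono_onD[OF F(3), of x y] that by auto
  have "strict_mono ?r"
  proof (rule strict_monoI)
    fix x y :: real assume "x < y"
    then show "?r x < ?r y" using less[of x y] le[of x] le[of y] by (auto simp: restrict_id_def)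
  qed
  moreover have "surj ?r"
    unfolding surj_def
  proof
    fix y show "\<exists>x. y = ?r x"
    proof (cases "0 \<le> y \<and> y \<le> 1")
      case True
      then obtain x where "x \<in> {0..1}" "f x = y" using F(5) by (metis atLeastAtMost_iff imageE)
      then show ?thesis by (intro exI[of _ x]) (auto simp: restrict_id_def)
    qed (intro exI[of _ y], auto simp: restrict_id_def)
  qed
  moreover have "\<exists>m>0. germ_slope ?r c d m" for c d
  proof (rule restrict_id_germ)
    obtain B where B: "finite B" "\<And>a b. 0 \<le> a \<Longrightarrow> a < b \<Longrightarrow> b \<le> 1 \<Longrightarrow> {a<..<b} \<inter> B = {} \<Longrightarrow>
           (\<exists>m c. \<forall>x\<in>{a..b}. f x = m * x + c)"
      using F(4) unfolding piecewise_linear_on_I_def by auto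
    have piece: "\<exists>m>0. \<exists>k. \<forall>x\<in>{a..b}. f x = m * x + k"
      if ab: "0 \<le> a" "a < b" "b \<le> 1" "{a<..<b} \<inter> B = {}" for a b
    proof -
      obtain m k where mk: "\<forall>x\<in>{a..b}. f x = m * x + k" using B(2)[OF ab] by blast
      have "m * a < m * b" using less[OF ab(1-3)] mk ab(2) by auto
      then have "m > 0" using ab(2) mult_le_cancel_left[of m b a] by (auto simp: not_le mult_less_cancel_left)
      then show ?thesis using mk by blast
    qed
    fix c d :: real assume c: "0 \<le> c" "c \<le> 1" and "(d > 0 \<and> c < 1) \<or> (d < 0 \<and> 0 < c)"
    then show "\<exists>m>0. germ_slope f c d m"
    proof (elim disjE conjE)
      assume d: "d > 0" "c < 1"
      define b where "b = Min (insert 1 {x \<in> B. c < x})"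
      have b: "c < b" "b \<le> 1" "{c<..<b} \<inter> B = {}"
        using B(1) d(2) by (auto simp: b_def)
      obtain m k where mk: "m > 0" "\<forall>x\<in>{c..b}. f x = m * x + k" using piece[OF c(1) b] by blast
      have "germ_slope f c d m" unfolding germ_slope_def
      proof (intro exI[of _ "(b - c) / d"] conjI allI impI)
        show "(b - c) / d > 0" using b d by simp
        fix y :: real assume "0 \<le> y \<and> y \<le> (b - c) / d"
        then have "0 \<le> d * y" "d * y \<le> b - c" using d by (auto simp: pos_le_divide_eq mult.commute)
        then show "f (c + d * y) = f c + m * d * y" using mk(2) b(1) by (simp add: algebra_simps)
      qed
      then show ?thesis using mk(1) by blast
    next
      assume d: "d < 0" "0 < c"
      define a where "a = Max (insert 0 {x \<in> B. x < c})"
      have a: "0 \<le> a" "a < c" "{a<..<c} \<inter> B = {}"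
        using B(1) d(2) by (auto simp: a_def)
      obtain m k where mk: "m > 0" "\<forall>x\<in>{a..c}. f x = m * x + k" using piece[OF a(1,2) c(2) a(3)] by blast
      have "germ_slope f c d m" unfolding germ_slope_def
      proof (intro exI[of _ "(c - a) / (- d)"] conjI allI impI)
        show "(c - a) / (- d) > 0" using a d by (intro divide_pos_pos) auto
        fix y :: real assume y: "0 \<le> y \<and> y \<le> (c - a) / (- d)"
        have "0 \<le> (- d) * y" "y * (- d) \<le> c - a" using d y pos_le_divide_eq[of "- d" y "c - a"] by (auto intro: mult_nonneg_nonneg simp: mult_nonpos_nonneg)
        then have "a \<le> c + d * y" "c + d * y \<le> c" by (simp_all add: mult.commute)
        then show "f (c + d * y) = f c + m * d * y" using mk(2) a(2) by (simp add: algebra_simps)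
      qed
      then show ?thesis using mk(1) by blast
    qed
  qed (use F in simp_all)
  ultimately show ?thesis by (auto simp: PLH_def restrict_id_def)
qed

lemma extend_PL_o_hom: "restrict_id 0 1 \<in> hom PL_o PLH"
proof (rule homI)
  fix f g assume fg: "f \<in> carrier PL_o" "g \<in> carrier PL_o"
  have "f \<otimes>\<^bsub>PL_o\<^esub> g = compose {0..1} f g"
    using PL_o_D(1) fg by (simp add: PL_o_def BijGroup_def)
  moreover have "0 \<le> g x \<and> g x \<le> 1" if "0 \<le> x" "x \<le> 1" for x
    using PL_o_D(5)[OF fg(2)] that by (metis atLeastAtMost_iff imageI)
  ultimately show "restrict_id 0 1 (f \<otimes>\<^bsub>PL_o\<^esub> g) = restrict_id 0 1 f \<otimes>\<^bsub>PLH\<^esub> restrict_id 0 1 g"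
    by (auto simp: restrict_id_def compose_def fun_eq_iff)
qed (rule extend_PL_o_mem_PLH)

lemma extend_PL_o_inj: "inj_on (restrict_id 0 1) (carrier PL_o)"
proof (rule inj_onI)
  fix f g assume fg: "f \<in> carrier PL_o" "g \<in> carrier PL_o" "restrict_id 0 1 f = restrict_id 0 1 g"
  have "f x = g x" if "x \<in> {0..1}" for x
    using fun_cong[OF fg(3), of x] that by (simp add: restrict_id_def)
  then show "f = g" using PL_o_D(2) fg by (metis extensionalityI)
qed

theorem lemma1p3:
  fixes G :: "(real \<Rightarrow> real) set" and n :: nat
  assumes "subgroup G PL_o"
    and "solvable (PL_o\<lparr>carrier := G\<rparr>)"
    and "derived_length (PL_o\<lparr>carrier := G\<rparr>) = n"
  shows "\<exists>K. subgroup K (G_tower n) \<and>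
           PL_o\<lparr>carrier := G\<rparr> \<cong> (G_tower n)\<lparr>carrier := K\<rparr>"
proof -
  let ?G = "PL_o\<lparr>carrier := G\<rparr>"
  let ?E = "restrict_id 0 1"
  have gG: "group ?G" using subgroup.subgroup_is_group[OF assms(1) group_PL_o] .
  have sub: "G \<subseteq> carrier PL_o" using subgroup.subset[OF assms(1)] .
  have E_hom: "?E \<in> hom ?G PLH" using extend_PL_o_hom sub by (auto simp: hom_def subset_iff)
  interpret E: group_hom ?G PLH ?E
    using E_hom gG group_PLH by (simp add: group_hom_def group_hom_axioms_def)
  have "\<exists>n. (derived ?G ^^ n) (carrier ?G) = {\<one>\<^bsub>?G\<^esub>}"
    using group.solvable_iff_trivial_derived_seq[OF gG] assms(2) by blast
  then have "(derived ?G ^^ n) (carrier ?G) = {\<one>\<^bsub>?G\<^esub>}"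
    unfolding assms(3)[symmetric] derived_length_def by (rule LeastI_ex)
  then have "(derived PLH ^^ n) (?E ` G) = ?E ` {\<one>\<^bsub>?G\<^esub>}"
    using E.exp_of_derived_img[of "carrier ?G" n] by simp
  also have "\<dots> = {id}" using E.hom_one by simp
  finally have der: "(derived PLH ^^ n) (?E ` G) \<subseteq> {id}" by simp
  have "subgroup (?E ` G) PLH" using E.img_is_subgroup by simp
  from solvable_subgroup_of_PLH_embeds[OF this der]
  obtain h where h: "h \<in> hom (PLH\<lparr>carrier := ?E ` G\<rparr>) (G_tower n)" "inj_on h (?E ` G)" by blast
  have "?E \<in> hom ?G (PLH\<lparr>carrier := ?E ` G\<rparr>)" using E_hom by (auto simp: hom_def)
  then have hom: "h \<circ> ?E \<in> hom ?G (G_tower n)" using h(1) by (rule hom_compose)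
  interpret H: group_hom ?G "G_tower n" "h \<circ> ?E"
    using hom gG group_G_tower by (simp add: group_hom_def group_hom_axioms_def)
  have inj: "inj_on (h \<circ> ?E) G"
    using comp_inj_on[OF inj_on_subset[OF extend_PL_o_inj sub] h(2)] .
  let ?K = "(h \<circ> ?E) ` G"
  have "subgroup ?K (G_tower n)" using H.img_is_subgroup by simp
  moreover have "h \<circ> ?E \<in> iso ?G ((G_tower n)\<lparr>carrier := ?K\<rparr>)"
    using hom inj by (auto simp: iso_def hom_def bij_betw_def)
  ultimately show ?thesis unfolding is_iso_def by blast
qed

end
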